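(* Let $T$ be a restricted Lie color triple system over a field $\mathbf{K}$ of characteristic $p>3$ with center $Z(T)=0$. Then $L_D(T)=T\oplus\mathrm{Der}(T)$ is a restricted Lie color algebra, with a restricted structure extending that of $T$ (i.e. $L_D(T)$ carries a $p$-map whose restriction to $T_\gamma\subset L_D(T)_\gamma$ is the given $p$-map of $T$ for every $\gamma\in G_+$).
   Context: $(G,+)$ is an abelian group and $\varepsilon:G\times G\to\mathbf{K}^*$ is a bicharacter: $\varepsilon(\alpha+\beta,\gamma)=\varepsilon(\alpha,\gamma)\varepsilon(\beta,\gamma)$, $\varepsilon(\alpha,\beta+\gamma)=\varepsilon(\alpha,\beta)\varepsilon(\alpha,\gamma)$, $\varepsilon(\alpha,\beta)\varepsilon(\beta,\alpha)=1$. $G_+=\{\gamma:\varepsilon(\gamma,\gamma)=1\}$. $\mathcal{H}(V)$ is the set of homogeneous elements of a $G$-graded space $V$, and $\bar x$ the degree of $x\in\mathcal H(V)$. Lie color algebra: $G$-graded space $L$ with bilinear bracket, $[L_i,L_j]\subset L_{i+j}$, and for homogeneous $x,y,z$: $[x,y]=-\varepsilon(\bar x,\bar y)[y,x]$, $\varepsilon(\bar z,\bar x)[x,[y,z]]+\varepsilon(\bar x,\bar y)[y,[z,x]]+\varepsilon(\bar y,\bar z)[z,[x,y]]=0$; $\operatorname{ad}_x(y)=[x,y]$. It is restricted if equipped with maps $(\cdot)^{[p]}:L_\gamma\to L_{p\gamma}$ for $\gamma\in G_+$ (a $p$-map) with: $(\alpha x)^{[p]}=\alpha^px^{[p]}$;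 $[x^{[p]},y]=(\operatorname{ad}_x)^p(y)$ for $x\in L_\gamma,y\in L$; $(x+y)^{[p]}=x^{[p]}+y^{[p]}+\sum_{i=1}^{p-1}s_i(x,y)$ for $x,y\in L_\gamma$, where $i s_i(x,y)$ is the coefficient of $\lambda^{i-1}$ in $(\operatorname{ad}_{\lambda x+y})^{p-1}(x)$. Lie color triple system: $G$-graded space $T$ with trilinear $[\cdot,\cdot,\cdot]$ such that $[T_i,T_j,T_k]\subset T_{i+j+k}$ and for homogeneous elements: $[x,y,z]=-\varepsilon(\bar x,\bar y)[y,x,z]$; $\varepsilon(\bar z,\bar x)[x,y,z]+\varepsilon(\bar x,\bar y)[y,z,x]+\varepsilon(\bar y,\bar z)[z,x,y]=0$; $[u,v,[x,y,z]]=[[u,v,x],y,z]+\varepsilon(\bar u+\bar v,\bar x)[x,[u,v,y],z]+\varepsilon(\bar u+\bar v,\bar x+\bar y)[x,y,[u,v,z]]$. For odd $n\ge 3$, $(x_1,\dots,x_n)=[[\cdots[[x_1,x_2,x_3],x_4,x_5],\cdots],x_{n-1},x_n]$. $T$ is restricted if equipped with maps $(\cdot)^{[p]}:T_\gamma\to T_{p\gamma}$, $\gamma\in G_+$, with: $(\alpha x)^{[p]}=\alpha^px^{[p]}$ for $\alpha\in\mathbf{K}$, $x\in T_\gamma$; $(x+y)^{[p]}=x^{[p]}+y^{[p]}+\sum_{i=1}^{p-1}s_i(x,y)$ for $x,y\in T_\gamma$, where $i s_i(x,y)$ is the coefficient of $Z^{i-1}$ in $(x,Zx+y,\dots,Zx+y)$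 ($Zx+y$ occurring $p-1$ times); $[x,y^{[p]},z]=(x,y,\dots,y,z)$ ($p$ copies of $y$) for $y\in T_\gamma$, $x,z\in T$. Center: $Z(T)=\{x\in T:[x,y,z]=0\ \forall y,z\in T\}$. A color derivation of degree $\alpha$ of $T$ is a linear map $D$ with $D(T_\gamma)\subset T_{\alpha+\gamma}$ and $D([x,y,z])=[D(x),y,z]+\varepsilon(\alpha,\bar x)[x,D(y),z]+\varepsilon(\alpha,\bar x+\bar y)[x,y,D(z)]$ for $x,y\in\mathcal H(T)$, $z\in T$; these form $\mathrm{Der}(T)_\alpha$, and $\mathrm{Der}(T)=\bigoplus_\alpha\mathrm{Der}(T)_\alpha$. For $x,y\in T$ put $D_{x,y}(z)=[x,y,z]$. $L_D(T)$ is the $G$-graded space with $L_D(T)_i=T_i\oplus\mathrm{Der}(T)_i$ and bracket, for homogeneous $x,y\in T$, $D,D'\in\mathrm{Der}(T)$: $[x,y]=D_{x,y}$, $[D,x]=D(x)$, $[x,D]=-\varepsilon(\bar x,\bar D)D(x)$, $[D,D']=DD'-\varepsilon(\bar D,\bar D')D'D$; this is a Lie color algebra. *)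

theory Defs
  imports
    "HOL-Computational_Algebra.Computational_Algebra"
    "HOL-Library.Function_Algebras"
    "HOL-Library.Product_Plus"
begin

section \<open>Bicharacters and graded spaces\<close>

locale bicharacter =
  fixes eps :: "'g::ab_group_add \<Rightarrow> 'g \<Rightarrow> 'k::field"
  assumes eps_nonzero: "eps a b \<noteq> 0"
    and eps_add_left: "eps (a + b) c = eps a c * eps b c"
    and eps_add_right: "eps a (b + c) = eps a b * eps a c"
    and eps_commute: "eps a b * eps b a = 1"

definition even_degrees :: "('g \<Rightarrow> 'g \<Rightarrow> 'k::one) \<Rightarrow> 'g set" where
  "even_degrees eps = {c. eps c c = 1}"

definition nat_mult :: "nat \<Rightarrow> 'g::comm_monoid_add \<Rightarrow> 'g" where
  "nat_mult n c = (\<Sum>_<n. c)"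

text \<open>
  The graded space is the internal direct sum of the subspaces \<open>V g\<close> of the ambient
  vector space; it need not exhaust the ambient type.
\<close>

locale graded_space = vector_space scale
  for scale :: "'k::field \<Rightarrow> 'v::ab_group_add \<Rightarrow> 'v" +
  fixes V :: "'g::ab_group_add \<Rightarrow> 'v set"
  assumes subspace_component: "subspace (V g)"
    and independent_components:
      "\<lbrakk>finite I; \<And>g. g \<in> I \<Longrightarrow> f g \<in> V g; (\<Sum>g\<in>I. f g) = 0; g \<in> I\<rbrakk> \<Longrightarrow> f g = 0"
begin

definition total :: "'v set" where
  "total = span (\<Union>g. V g)"

end

text \<open>The family of homogeneous components of an element of the direct sum of the \<open>V g\<close>.\<close>

definition components :: "('g \<Rightarrow> 'v::comm_monoid_add set) \<Rightarrow> 'v \<Rightarrow> 'g \<Rightarrow> 'v" where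
  "components V x = (THE f. finite {g. f g \<noteq> 0} \<and> (\<forall>g. f g \<in> V g) \<and> x = (\<Sum>g | f g \<noteq> 0. f g))"

definition degrees :: "('g \<Rightarrow> 'v::comm_monoid_add set) \<Rightarrow> 'v \<Rightarrow> 'g set" where
  "degrees V x = {g. components V x g \<noteq> 0}"


section \<open>Restricted Lie color algebras\<close>

locale lie_color_algebra = graded_space scale L + bicharacter eps
  for scale :: "'k::field \<Rightarrow> 'v::ab_group_add \<Rightarrow> 'v"
    and L :: "'g::ab_group_add \<Rightarrow> 'v set"
    and eps :: "'g \<Rightarrow> 'g \<Rightarrow> 'k" +
  fixes br :: "'v \<Rightarrow> 'v \<Rightarrow> 'v"
  assumes br_add_left:
      "\<lbrakk>x \<in> total; y \<in> total; z \<in> total\<rbrakk> \<Longrightarrow> br (x + y) z = br x z + br y z"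
    and br_add_right:
      "\<lbrakk>x \<in> total; y \<in> total; z \<in> total\<rbrakk> \<Longrightarrow> br x (y + z) = br x y + br x z"
    and br_scale_left: "\<lbrakk>x \<in> total; y \<in> total\<rbrakk> \<Longrightarrow> br (scale c x) y = scale c (br x y)"
    and br_scale_right: "\<lbrakk>x \<in> total; y \<in> total\<rbrakk> \<Longrightarrow> br x (scale c y) = scale c (br x y)"
    and br_degree: "\<lbrakk>x \<in> L i; y \<in> L j\<rbrakk> \<Longrightarrow> br x y \<in> L (i + j)"
    and br_skew: "\<lbrakk>x \<in> L i; y \<in> L j\<rbrakk> \<Longrightarrow> br x y = - scale (eps i j) (br y x)"
    and br_jacobi: "\<lbrakk>x \<in> L i; y \<in> L j; z \<in> L k\<rbrakk> \<Longrightarrow>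
      scale (eps k i) (br x (br y z)) + scale (eps i j) (br y (br z x))
        + scale (eps j k) (br z (br x y)) = 0"

text \<open>
  Polynomials in one indeterminate with coefficients in the underlying space; a bilinear
  (trilinear) operation extends to them by \<open>K[Z]\<close>-linearity. The polynomial \<open>Zx + y\<close>
  is \<open>[:y, x:]\<close>.
\<close>

definition poly_bilinear ::
  "('v::comm_monoid_add \<Rightarrow> 'v \<Rightarrow> 'v) \<Rightarrow> 'v poly \<Rightarrow> 'v poly \<Rightarrow> 'v poly" where
  "poly_bilinear br f g =
    (\<Sum>i\<le>degree f. \<Sum>j\<le>degree g. monom (br (coeff f i) (coeff g j)) (i + j))"

definition poly_trilinear ::
  "('v::comm_monoid_add \<Rightarrow> 'v \<Rightarrow> 'v \<Rightarrow> 'v) \<Rightarrow> 'v poly \<Rightarrow> 'v poly \<Rightarrow> 'v poly \<Rightarrow> 'v poly" where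
  "poly_trilinear br f g h =
    (\<Sum>i\<le>degree f. \<Sum>j\<le>degree g. \<Sum>k\<le>degree h.
      monom (br (coeff f i) (coeff g j) (coeff h k)) (i + j + k))"

definition lie_s ::
  "('k::field \<Rightarrow> 'v::comm_monoid_add \<Rightarrow> 'v) \<Rightarrow> ('v \<Rightarrow> 'v \<Rightarrow> 'v) \<Rightarrow> nat \<Rightarrow> nat \<Rightarrow> 'v \<Rightarrow> 'v \<Rightarrow> 'v"
  where "lie_s scale br p i x y =
    scale (inverse (of_nat i)) (coeff ((poly_bilinear br [:y, x:] ^^ (p - 1)) [:x:]) (i - 1))"

text \<open>The \<open>p\<close>-map is a family: \<open>pm c\<close> is the map on the component of degree \<open>c\<close>.\<close>

locale restricted_lie_color_algebra = lie_color_algebra scale L eps br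
  for scale :: "'k::field \<Rightarrow> 'v::ab_group_add \<Rightarrow> 'v"
    and L :: "'g::ab_group_add \<Rightarrow> 'v set"
    and eps :: "'g \<Rightarrow> 'g \<Rightarrow> 'k"
    and br :: "'v \<Rightarrow> 'v \<Rightarrow> 'v" +
  fixes p :: nat and pm :: "'g \<Rightarrow> 'v \<Rightarrow> 'v"
  assumes pm_degree: "\<lbrakk>c \<in> even_degrees eps; x \<in> L c\<rbrakk> \<Longrightarrow> pm c x \<in> L (nat_mult p c)"
    and pm_scale:
      "\<lbrakk>c \<in> even_degrees eps; x \<in> L c\<rbrakk> \<Longrightarrow> pm c (scale a x) = scale (a ^ p) (pm c x)"
    and pm_ad:
      "\<lbrakk>c \<in> even_degrees eps; x \<in> L c; y \<in> total\<rbrakk> \<Longrightarrow> br (pm c x) y = (br x ^^ p) y"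
    and pm_add: "\<lbrakk>c \<in> even_degrees eps; x \<in> L c; y \<in> L c\<rbrakk> \<Longrightarrow>
      pm c (x + y) = pm c x + pm c y + (\<Sum>i = 1..p - 1. lie_s scale br p i x y)"


section \<open>Restricted Lie color triple systems\<close>

locale lie_color_triple_system = graded_space scale T + bicharacter eps
  for scale :: "'k::field \<Rightarrow> 't::ab_group_add \<Rightarrow> 't"
    and T :: "'g::ab_group_add \<Rightarrow> 't set"
    and eps :: "'g \<Rightarrow> 'g \<Rightarrow> 'k" +
  fixes br :: "'t \<Rightarrow> 't \<Rightarrow> 't \<Rightarrow> 't"
  assumes total_UNIV: "total = UNIV"
    and br_linear1: "Vector_Spaces.linear scale scale (\<lambda>x. br x y z)"
    and br_linear2: "Vector_Spaces.linear scale scale (\<lambda>y. br x y z)"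
    and br_linear3: "Vector_Spaces.linear scale scale (\<lambda>z. br x y z)"
    and br_degree: "\<lbrakk>x \<in> T i; y \<in> T j; z \<in> T k\<rbrakk> \<Longrightarrow> br x y z \<in> T (i + j + k)"
    and br_skew: "\<lbrakk>x \<in> T i; y \<in> T j; z \<in> T k\<rbrakk> \<Longrightarrow> br x y z = - scale (eps i j) (br y x z)"
    and br_cyclic: "\<lbrakk>x \<in> T i; y \<in> T j; z \<in> T k\<rbrakk> \<Longrightarrow>
      scale (eps k i) (br x y z) + scale (eps i j) (br y z x) + scale (eps j k) (br z x y) = 0"
    and br_derivation:
      "\<lbrakk>u \<in> T l; v \<in> T m; x \<in> T i; y \<in> T j; z \<in> T k\<rbrakk> \<Longrightarrow>
        br u v (br x y z) = br (br u v x) y z + scale (eps (l + m) i) (br x (br u v y) z)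
          + scale (eps (l + m) (i + j)) (br x y (br u v z))"

text \<open>\<open>(x\<^sub>1, \<dots>, x\<^sub>n)\<close> for odd \<open>n\<close>; lists of even length are junk.\<close>

fun iterated :: "('v \<Rightarrow> 'v \<Rightarrow> 'v \<Rightarrow> 'v) \<Rightarrow> 'v list \<Rightarrow> 'v" where
  "iterated br (x # y # z # ws) = iterated br (br x y z # ws)"
| "iterated br [x] = x"
| "iterated br [] = undefined"
| "iterated br [x, y] = undefined"

definition triple_s ::
  "('k::field \<Rightarrow> 't::comm_monoid_add \<Rightarrow> 't) \<Rightarrow> ('t \<Rightarrow> 't \<Rightarrow> 't \<Rightarrow> 't) \<Rightarrow> nat \<Rightarrow> nat \<Rightarrow> 't \<Rightarrow> 't \<Rightarrow> 't"
  where "triple_s scale br p i x y =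
    scale (inverse (of_nat i))
      (coeff (iterated (poly_trilinear br) ([:x:] # replicate (p - 1) [:y, x:])) (i - 1))"

locale restricted_lie_color_triple_system = lie_color_triple_system scale T eps br
  for scale :: "'k::field \<Rightarrow> 't::ab_group_add \<Rightarrow> 't"
    and T :: "'g::ab_group_add \<Rightarrow> 't set"
    and eps :: "'g \<Rightarrow> 'g \<Rightarrow> 'k"
    and br :: "'t \<Rightarrow> 't \<Rightarrow> 't \<Rightarrow> 't" +
  fixes p :: nat and pm :: "'g \<Rightarrow> 't \<Rightarrow> 't"
  assumes pm_degree: "\<lbrakk>c \<in> even_degrees eps; x \<in> T c\<rbrakk> \<Longrightarrow> pm c x \<in> T (nat_mult p c)"
    and pm_scale:
      "\<lbrakk>c \<in> even_degrees eps; x \<in> T c\<rbrakk> \<Longrightarrow> pm c (scale a x) = scale (a ^ p) (pm c x)"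
    and pm_add: "\<lbrakk>c \<in> even_degrees eps; x \<in> T c; y \<in> T c\<rbrakk> \<Longrightarrow>
      pm c (x + y) = pm c x + pm c y + (\<Sum>i = 1..p - 1. triple_s scale br p i x y)"
    and pm_br: "\<lbrakk>c \<in> even_degrees eps; y \<in> T c\<rbrakk> \<Longrightarrow>
      br x (pm c y) z = iterated br (x # replicate p y @ [z])"

definition triple_center :: "('t \<Rightarrow> 't \<Rightarrow> 't \<Rightarrow> 't::zero) \<Rightarrow> 't set" where
  "triple_center br = {x. \<forall>y z. br x y z = 0}"


section \<open>Color derivations and the algebra \<open>L\<^sub>D(T) = T \<oplus> Der(T)\<close>\<close>

definition color_der ::
  "('k::field \<Rightarrow> 't::ab_group_add \<Rightarrow> 't) \<Rightarrow> ('g::ab_group_add \<Rightarrow> 't set) \<Rightarrow> ('g \<Rightarrow> 'g \<Rightarrow> 'k) \<Rightarrow>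
    ('t \<Rightarrow> 't \<Rightarrow> 't \<Rightarrow> 't) \<Rightarrow> 'g \<Rightarrow> ('t \<Rightarrow> 't) set" where
  "color_der scale T eps br a = {D. Vector_Spaces.linear scale scale D \<and>
    (\<forall>c. D ` T c \<subseteq> T (a + c)) \<and>
    (\<forall>i j. \<forall>x\<in>T i. \<forall>y\<in>T j. \<forall>z.
      D (br x y z) = br (D x) y z + scale (eps a i) (br x (D y) z)
        + scale (eps a (i + j)) (br x y (D z)))}"

text \<open>
  \<open>L\<^sub>D(T)\<close> lives in the space of pairs \<open>(x, D)\<close> of an element and a self-map of \<open>T\<close>, with
  the componentwise operations; its underlying space is the sum of the \<open>LD_component\<close>s.
\<close>

definition LD_scale :: "('k \<Rightarrow> 't \<Rightarrow> 't) \<Rightarrow> 'k \<Rightarrow> 't \<times> ('t \<Rightarrow> 't) \<Rightarrow> 't \<times> ('t \<Rightarrow> 't)" where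
  "LD_scale scale c = (\<lambda>(x, D). (scale c x, \<lambda>z. scale c (D z)))"

definition LD_component ::
  "('k::field \<Rightarrow> 't::ab_group_add \<Rightarrow> 't) \<Rightarrow> ('g::ab_group_add \<Rightarrow> 't set) \<Rightarrow> ('g \<Rightarrow> 'g \<Rightarrow> 'k) \<Rightarrow>
    ('t \<Rightarrow> 't \<Rightarrow> 't \<Rightarrow> 't) \<Rightarrow> 'g \<Rightarrow> ('t \<times> ('t \<Rightarrow> 't)) set" where
  "LD_component scale T eps br i = T i \<times> color_der scale T eps br i"

text \<open>
  The bilinear extension of \<open>[x, y] = D\<^bsub>x,y\<^esub>\<close>, \<open>[D, y] = D(y)\<close>, \<open>[x, E] = -\<epsilon>(i, j) E(x)\<close> and
  \<open>[D, E] = DE - \<epsilon>(i, j) ED\<close> for \<open>x\<close>, \<open>D\<close> of degree \<open>i\<close> and \<open>y\<close>, \<open>E\<close> of degree \<open>j\<close>: the terms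
  carrying a factor \<open>\<epsilon>\<close> are summed over the homogeneous components of the two arguments.
\<close>

definition LD_bracket ::
  "('k::field \<Rightarrow> 't::ab_group_add \<Rightarrow> 't) \<Rightarrow> ('g::ab_group_add \<Rightarrow> 't set) \<Rightarrow> ('g \<Rightarrow> 'g \<Rightarrow> 'k) \<Rightarrow>
    ('t \<Rightarrow> 't \<Rightarrow> 't \<Rightarrow> 't) \<Rightarrow> 't \<times> ('t \<Rightarrow> 't) \<Rightarrow> 't \<times> ('t \<Rightarrow> 't) \<Rightarrow> 't \<times> ('t \<Rightarrow> 't)" where
  "LD_bracket scale T eps br = (\<lambda>(x, D) (y, E).
    let Der = color_der scale T eps br in
    (D y - (\<Sum>i\<in>degrees T x. \<Sum>j\<in>degrees Der E.
        scale (eps i j) (components Der E j (components T x i))),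
     \<lambda>z. br x y z + D (E z) - (\<Sum>i\<in>degrees Der D. \<Sum>j\<in>degrees Der E.
        scale (eps i j) (components Der E j (components Der D i z)))))"

end

(*
  For homogeneous x of even degree c, color commutators with x and with elements of degree n c are
  ordinary commutators, so Jacobson's formula (ad(x+y))^p = (ad x)^p + (ad y)^p + sum ad(s_i(x,y))
  holds in the ring of additive endomorphisms. Hence a Lie color algebra with faithful adjoint
  representation is restricted, with a unique p-map, as soon as (ad x)^p is inner for x in a
  spanning set of each even component. Since Z(T) = 0, the algebra L_D(T) is faithful already on T,
  so an element W represents (ad X)^p once it does so on T. For X = x in T take W = x^[p]: this
  is the axiom on [y, x^[p], z]. For X = D in Der(T) take W = D^p, which is a derivation
  by the Leibniz rule in characteristic p.
*)

theory Submission
  imports Defs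
begin

section \<open>Commutators in a ring\<close>

text \<open>The computations with \<open>(ad x)^p\<close> are ring identities, but the laws of
  \<open>br\<close> hold only on \<open>total\<close>, which may be smaller than the ambient type. A
  linear projection onto \<open>total\<close> therefore turns each \<open>ad x\<close> into an
  additive map of the whole type. Scalars become elements of the same ring, so that the factor
  \<open>eps i j\<close> of a color commutator is an element \<open>q\<close> commuting with
  \<open>ad x\<close>. Formal power series over this ring supply the indeterminate of the
  \<open>s_i\<close>, since they multiply over noncommutative coefficients. Even degree enters
  through \<open>eps c c = 1\<close>: the twist between \<open>x\<close> and
  \<open>(ad x)^n y\<close> then does not depend on \<open>n\<close>. Homogeneity and additivity of
  the p-map need no computation with its values: both sides represent the same power
  \<open>(ad z)^p\<close>, and faithfulness identifies them. For the same reason the constructed map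
  agrees with the given one on \<open>T\<close>.\<close>

text \<open>Left multiplication by \<open>c\<close> and the map sending \<open>u\<close> to
  \<open>q * u * c\<close> commute because \<open>q\<close> commutes with \<open>c\<close>, so
  powers of their difference expand by the binomial theorem. With \<open>q = 1\<close> this is the
  ordinary commutator; for color brackets \<open>q\<close> is the scalar
  \<open>eps c d\<close>.\<close>

lemma twisted_commutator_funpow:
  fixes c a q :: "'a::ring_1"
  assumes qc: "q * c = c * q" and qa: "q * a = a * q"
  shows "((\<lambda>u. c * u - q * u * c) ^^ n) a =
    (\<Sum>k\<le>n. of_nat (n choose k) * ((-q) ^ k * c ^ (n - k) * a * c ^ k))"
proof (induction n)
  case 0
  then show ?case by simp
next
  case (Suc n)
  define t where "t m k = (-q) ^ k * c ^ (m - k) * a * c ^ k" for m k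
  have qpc: "c * (-q) ^ k = (-q) ^ k * c" for k
    by (rule power_commuting_commutes[symmetric]) (simp add: qc)
  have left: "c * t n k = t (Suc n) k" if "k \<le> n" for k
  proof -
    have "c * t n k = (c * (-q) ^ k) * c ^ (n - k) * a * c ^ k"
      by (simp add: t_def mult.assoc)
    also have "\<dots> = t (Suc n) k"
      using that by (simp add: qpc t_def Suc_diff_le mult.assoc)
    finally show ?thesis .
  qed
  have right: "q * t n k * c = - t (Suc n) (Suc k)" for k
    by (simp add: t_def mult.assoc power_commutes)
  have com: "x * (of_nat m * y) = of_nat m * (x * y)" for x y :: 'a and m
    by (metis mult.assoc mult_of_nat_commute)
  have "((\<lambda>u. c * u - q * u * c) ^^ Suc n) a =
      c * (\<Sum>k\<le>n. of_nat (n choose k) * t n k) - q * (\<Sum>k\<le>n. of_nat (n choose k) * t n k) * c"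
    by (simp add: Suc.IH t_def)
  also have "\<dots> = (\<Sum>k\<le>n. c * (of_nat (n choose k) * t n k) - q * (of_nat (n choose k) * t n k) * c)"
    by (simp only: sum_distrib_left sum_distrib_right sum_subtractf)
  also have "\<dots> = (\<Sum>k\<le>n. of_nat (n choose k) * t (Suc n) k
      + of_nat (n choose k) * t (Suc n) (Suc k))"
  proof (rule sum.cong)
    fix k assume "k \<in> {..n}"
    then have "c * (of_nat (n choose k) * t n k) = of_nat (n choose k) * t (Suc n) k"
      by (simp only: com left atMost_iff)
    moreover have "q * (of_nat (n choose k) * t n k) * c = - (of_nat (n choose k) * t (Suc n) (Suc k))"
      by (simp only: com mult.assoc[of "of_nat (n choose k)"] right mult_minus_right)
    ultimately show "c * (of_nat (n choose k) * t n k) - q * (of_nat (n choose k) * t n k) * c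
      = of_nat (n choose k) * t (Suc n) k + of_nat (n choose k) * t (Suc n) (Suc k)"
      by simp
  qed simp
  also have "\<dots> = (\<Sum>k\<le>n. of_nat (n choose k) * t (Suc n) k)
      + (\<Sum>k\<le>n. of_nat (n choose k) * t (Suc n) (Suc k))"
    by (rule sum.distrib)
  also have "(\<Sum>k\<le>n. of_nat (n choose k) * t (Suc n) k)
      = t (Suc n) 0 + (\<Sum>k\<le>n. of_nat (n choose Suc k) * t (Suc n) (Suc k))"
    using sum.atMost_Suc_shift[of "\<lambda>k. of_nat (n choose k) * t (Suc n) k" n]
    by (simp add: binomial_eq_0)
  also have "t (Suc n) 0 + (\<Sum>k\<le>n. of_nat (n choose Suc k) * t (Suc n) (Suc k))
      + (\<Sum>k\<le>n. of_nat (n choose k) * t (Suc n) (Suc k))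
      = t (Suc n) 0 + (\<Sum>k\<le>n. of_nat (Suc n choose Suc k) * t (Suc n) (Suc k))"
    by (simp only: binomial_Suc_Suc of_nat_add distrib_right sum.distrib add_ac)
  also have "\<dots> = (\<Sum>k\<le>Suc n. of_nat (Suc n choose k) * t (Suc n) k)"
    by (subst sum.atMost_Suc_shift) simp
  finally show ?case by (simp add: t_def)
qed

text \<open>The inner entries of row \<open>p\<close> of Pascal's triangle vanish modulo
  \<open>p\<close>, so neighbours in row \<open>p - 1\<close> are negatives of each other.\<close>

lemma of_nat_choose_pred_prime:
  assumes "prime p" and p0: "of_nat p = (0::'a::ring_1)" and "k < p"
  shows "of_nat (p - 1 choose k) = (- 1 :: 'a) ^ k"
  using \<open>k < p\<close>
proof (induction k)
  case 0
  then show ?case by simp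
next
  case (Suc k)
  have "p dvd (p choose Suc k)"
    using \<open>prime p\<close> Suc.prems by (intro dvd_choose_prime) auto
  then have "of_nat (p choose Suc k) = (0::'a)"
    by (metis dvdE mult_zero_left of_nat_mult p0)
  moreover have "p choose Suc k = (p - 1 choose k) + (p - 1 choose Suc k)"
    using Suc.prems by (cases p) auto
  ultimately show ?case
    using Suc by (simp add: eq_neg_iff_add_eq_0 add.commute)
qed

text \<open>The signs of the binomial coefficients cancel those of \<open>(-q) ^ k\<close>. For
  \<open>q = 1\<close> the result has the shape of a noncommutative derivative of
  \<open>c ^ p\<close>.\<close>

lemma twisted_commutator_pred_prime:
  fixes c a q :: "'a::ring_1"
  assumes p: "prime p" "of_nat p = (0::'a)"
    and qc: "q * c = c * q" and qa: "q * a = a * q"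
  shows "((\<lambda>u. c * u - q * u * c) ^^ (p - 1)) a = (\<Sum>k<p. q ^ k * c ^ (p - 1 - k) * a * c ^ k)"
proof -
  have "(- 1) ^ k * ((- q) ^ k * x) = q ^ k * x" for k and x :: 'a
    by (simp add: power_minus[of q k] minus_one_power_iff)
  moreover have "{..p - 1} = {..<p}"
    using prime_gt_0_nat[OF p(1)] by auto
  ultimately show ?thesis
    unfolding twisted_commutator_funpow[OF qc qa]
    by (intro sum.cong) (auto simp: of_nat_choose_pred_prime[OF p, unfolded One_nat_def] mult.assoc)
qed

text \<open>One further commutator makes the sum for \<open>p - 1\<close> telescope. This also
  yields the sign of the term with \<open>q ^ p\<close> without a case split on the parity of
  \<open>p\<close>.\<close>

lemma twisted_commutator_prime:
  fixes c a q :: "'a::ring_1"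
  assumes p: "prime p" "of_nat p = (0::'a)"
    and qc: "q * c = c * q" and qa: "q * a = a * q"
  shows "((\<lambda>u. c * u - q * u * c) ^^ p) a = c ^ p * a - q ^ p * a * c ^ p"
proof -
  define f where "f k = q ^ k * c ^ (p - k) * a * c ^ k" for k
  have qpc: "c * q ^ k = q ^ k * c" for k
    by (rule power_commuting_commutes[symmetric]) (simp add: qc)
  have "((\<lambda>u. c * u - q * u * c) ^^ p) a =
    (\<lambda>u. c * u - q * u * c) (((\<lambda>u. c * u - q * u * c) ^^ (p - 1)) a)"
    using prime_gt_0_nat[OF p(1)] by (cases p) auto
  also have "\<dots> = (\<Sum>k<p. c * (q ^ k * c ^ (p - 1 - k) * a * c ^ k)
      - q * (q ^ k * c ^ (p - 1 - k) * a * c ^ k) * c)"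
    unfolding twisted_commutator_pred_prime[OF assms]
    by (simp add: sum_distrib_left sum_distrib_right sum_subtractf)
  also have "\<dots> = (\<Sum>k<p. f k - f (Suc k))"
  proof (rule sum.cong)
    fix k assume "k \<in> {..<p}"
    then have "p - k = Suc (p - 1 - k)" by auto
    then have "c * (q ^ k * c ^ (p - 1 - k) * a * c ^ k) = f k"
      unfolding f_def by (simp add: qpc flip: mult.assoc)
    moreover have "q * (q ^ k * c ^ (p - 1 - k) * a * c ^ k) * c = f (Suc k)"
      by (simp add: f_def mult.assoc power_commutes)
    ultimately show "c * (q ^ k * c ^ (p - 1 - k) * a * c ^ k)
      - q * (q ^ k * c ^ (p - 1 - k) * a * c ^ k) * c = f k - f (Suc k)" by simp
  qed simp
  also have "\<dots> = f 0 - f p"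
    using sum_lessThan_telescope'[of f p] by simp
  finally show ?thesis by (simp add: f_def)
qed

section \<open>Powers of a noncommutative linear pencil and their derivatives\<close>

text \<open>\<open>c\<close> need not commute with its derivative, so the product rule places
  \<open>fps_deriv c\<close> at each of the \<open>n\<close> positions separately.\<close>

lemma fps_deriv_power_noncomm:
  fixes c :: "'a::ring_1 fps"
  shows "fps_deriv (c ^ n) = (\<Sum>k<n. c ^ (n - 1 - k) * fps_deriv c * c ^ k)"
proof (induction n)
  case (Suc n)
  have "fps_deriv (c ^ Suc n) = c * fps_deriv (c ^ n) + fps_deriv c * c ^ n"
    by simp
  also have "\<dots> = (\<Sum>k<n. c * (c ^ (n - 1 - k) * fps_deriv c * c ^ k)) + fps_deriv c * c ^ n"
    by (simp add: Suc.IH sum_distrib_left)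
  also have "(\<Sum>k<n. c * (c ^ (n - 1 - k) * fps_deriv c * c ^ k))
      = (\<Sum>k<n. c ^ (n - k) * fps_deriv c * c ^ k)"
    by (rule sum.cong) (auto simp: mult.assoc Suc_diff_Suc simp flip: power_Suc mult.assoc)
  finally show ?case by simp
qed simp

lemma pencil_mult_nth:
  fixes A B :: "'a::ring_1"
  defines "C \<equiv> fps_const B + fps_X * fps_const A"
  shows "fps_nth (C * u) n = B * fps_nth u n + (if n = 0 then 0 else A * fps_nth u (n - 1))"
    and "fps_nth (u * C) n = fps_nth u n * B + (if n = 0 then 0 else fps_nth u (n - 1) * A)"
proof -
  show "fps_nth (C * u) n = B * fps_nth u n + (if n = 0 then 0 else A * fps_nth u (n - 1))"
    by (simp add: C_def distrib_right mult.assoc)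
  have "u * (fps_X * fps_const A) = fps_X * (u * fps_const A)"
    by (metis fps_mult_fps_X_commute mult.assoc)
  then show "fps_nth (u * C) n = fps_nth u n * B + (if n = 0 then 0 else fps_nth u (n - 1) * A)"
    by (simp add: C_def distrib_left)
qed

text \<open>The last item stands in for evaluation at \<open>X = 1\<close>, which a formal power
  series does not admit in general: the coefficients above \<open>n\<close> vanish, so a finite sum
  takes its place.\<close>

lemma pencil_power_nth:
  fixes A B :: "'a::ring_1"
  defines "C \<equiv> fps_const B + fps_X * fps_const A"
  shows "fps_nth (C ^ n) 0 = B ^ n" and "fps_nth (C ^ n) n = A ^ n"
    and "n < i \<Longrightarrow> fps_nth (C ^ n) i = 0"
    and "(\<Sum>i\<le>n. fps_nth (C ^ n) i) = (A + B) ^ n"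
proof -
  have nth: "fps_nth (C ^ Suc n) i =
      B * fps_nth (C ^ n) i + (if i = 0 then 0 else A * fps_nth (C ^ n) (i - 1))" for n i
    using pencil_mult_nth(1)[of B A "C ^ n" i] by (simp add: C_def)
  show "fps_nth (C ^ n) 0 = B ^ n"
    by (induction n) (simp_all add: nth del: power.power_Suc, simp_all)
  show vanish: "fps_nth (C ^ n) i = 0" if "n < i" for n i
    using that
    by (induction n arbitrary: i) (simp_all add: nth del: power.power_Suc)
  show "fps_nth (C ^ n) n = A ^ n"
    by (induction n) (simp_all add: nth vanish del: power.power_Suc, simp_all)
  show "(\<Sum>i\<le>n. fps_nth (C ^ n) i) = (A + B) ^ n"
  proof (induction n)
    case (Suc n)
    have "(\<Sum>i\<le>Suc n. fps_nth (C ^ Suc n) i) =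
      B * (\<Sum>i\<le>Suc n. fps_nth (C ^ n) i)
      + (\<Sum>i\<le>Suc n. if i = 0 then 0 else A * fps_nth (C ^ n) (i - 1))"
      by (simp only: nth sum.distrib sum_distrib_left)
    also have "(\<Sum>i\<le>Suc n. fps_nth (C ^ n) i) = (\<Sum>i\<le>n. fps_nth (C ^ n) i)"
      by (simp add: vanish)
    also have "(\<Sum>i\<le>Suc n. if i = 0 then 0 else A * fps_nth (C ^ n) (i - 1))
       = A * (\<Sum>i\<le>n. fps_nth (C ^ n) i)"
      by (subst sum.atMost_Suc_shift) (simp add: sum_distrib_left)
    finally show ?case by (simp add: Suc.IH algebra_simps)
  qed simp
qed

text \<open>Both sides are the coefficient of \<open>X\<^sup>i\<^sup>-\<^sup>1\<close> in the derivative of \<open>(B + X A)\<^sup>p\<close>.\<close>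

lemma jacobson_coeff:
  fixes A B :: "'a::ring_1"
  defines "C \<equiv> fps_const B + fps_X * fps_const A"
  assumes p: "prime p" "of_nat p = (0::'a)" and "0 < i"
  shows "of_nat i * fps_nth (C ^ p) i
    = fps_nth (((\<lambda>u. C * u - u * C) ^^ (p - 1)) (fps_const A)) (i - 1)"
proof -
  have "of_nat p = (0 :: 'a fps)"
    by (simp add: fps_of_nat[symmetric] p)
  then have "((\<lambda>u. C * u - u * C) ^^ (p - 1)) (fps_const A)
      = (\<Sum>k<p. C ^ (p - 1 - k) * fps_const A * C ^ k)"
    using twisted_commutator_pred_prime[OF p(1), of 1 C "fps_const A"] by simp
  also have "fps_const A = fps_deriv C"
    by (simp add: C_def)
  finally have "((\<lambda>u. C * u - u * C) ^^ (p - 1)) (fps_const A) = fps_deriv (C ^ p)"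
    by (simp add: fps_deriv_power_noncomm \<open>fps_const A = fps_deriv C\<close>)
  then show ?thesis
    using \<open>0 < i\<close> by simp
qed

section \<open>The ring of additive maps\<close>

text \<open>The factor \<open>'k\<close> only ensures \<open>0 \<noteq> 1\<close>.\<close>

typedef (overloaded) ('k, 'v) endo =
  "{f :: 'k::field \<times> 'v::ab_group_add \<Rightarrow> 'k \<times> 'v. \<forall>x y. f (x + y) = f x + f y}"
  morphisms endo_apply Endo
  by (rule exI[of _ id]) simp

setup_lifting type_definition_endo

instantiation endo :: (field, ab_group_add) ring_1
begin

lift_definition zero_endo :: "('a, 'b) endo" is "\<lambda>x. 0" by simp
lift_definition one_endo :: "('a, 'b) endo" is "\<lambda>x. x" by simp
lift_definition plus_endo :: "('a, 'b) endo \<Rightarrow> ('a, 'b) endo \<Rightarrow> ('a, 'b) endo"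
  is "\<lambda>f g x. f x + g x" by (simp add: add_ac)
lift_definition minus_endo :: "('a, 'b) endo \<Rightarrow> ('a, 'b) endo \<Rightarrow> ('a, 'b) endo"
  is "\<lambda>f g x. f x - g x" by simp
lift_definition uminus_endo :: "('a, 'b) endo \<Rightarrow> ('a, 'b) endo"
  is "\<lambda>f x. - f x" by simp
lift_definition times_endo :: "('a, 'b) endo \<Rightarrow> ('a, 'b) endo \<Rightarrow> ('a, 'b) endo"
  is "\<lambda>f g x. f (g x)" by simp

lemma endo_apply_add: "endo_apply f (x + y) = endo_apply f x + endo_apply f y"
  using endo_apply by fastforce

lemmas endo_rep_eqs = zero_endo.rep_eq one_endo.rep_eq plus_endo.rep_eq minus_endo.rep_eq
  uminus_endo.rep_eq times_endo.rep_eq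

instance
proof
  have "endo_apply (0 :: ('a, 'b) endo) (1, 0) \<noteq> endo_apply 1 (1, 0)"
    by (simp add: endo_rep_eqs zero_prod_def)
  then show "(0 :: ('a, 'b) endo) \<noteq> 1"
    by metis
  fix a b c :: "('a, 'b) endo"
  show "a * b * c = a * (b * c)" "a + b + c = a + (b + c)" "a + b = b + a" "0 + a = a"
    "1 * a = a" "a * 1 = a" "- a + a = 0" "a - b = a + - b"
    "(a + b) * c = a * c + b * c" "a * (b + c) = a * b + a * c"
    by (simp_all only: endo_apply_inject[symmetric] fun_eq_iff endo_rep_eqs endo_apply_add)
      (simp_all only: add_ac add_0_left add.right_inverse diff_conv_add_uminus simp_thms)
qed

end

lemma endo_eqI: "(\<And>c v. endo_apply f (c, v) = endo_apply g (c, v)) \<Longrightarrow> f = g"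
  by (simp add: endo_apply_inject[symmetric] fun_eq_iff)

section \<open>Lie color algebras with inner p-th powers\<close>

lemma nat_mult_0: "nat_mult 0 c = 0"
  and nat_mult_Suc: "nat_mult (Suc n) c = c + nat_mult n c"
  by (simp_all add: nat_mult_def add.commute)

context bicharacter
begin

lemma eps_0_left: "eps 0 c = 1"
  using eps_add_left[of 0 0 c] eps_nonzero[of 0 c] by simp

lemma eps_0_right: "eps c 0 = 1"
  using eps_add_right[of c 0 0] eps_nonzero[of c 0] by simp

lemma eps_nat_mult_left: "eps (nat_mult n c) d = eps c d ^ n"
  by (induction n) (simp_all add: nat_mult_0 nat_mult_Suc eps_0_left eps_add_left)

lemma eps_nat_mult_right: "eps c (nat_mult n d) = eps c d ^ n"
  by (induction n) (simp_all add: nat_mult_0 nat_mult_Suc eps_0_right eps_add_right)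

end

context graded_space
begin

lemma subspace_total: "subspace total"
  by (simp add: total_def)

lemma component_total: "x \<in> V g \<Longrightarrow> x \<in> total"
  by (auto simp: total_def intro: span_base)

lemma total_induct [consumes 1, case_names zero homogeneous add]:
  assumes "x \<in> total" and "P 0" and "\<And>g x. x \<in> V g \<Longrightarrow> P x"
    and "\<And>x y. \<lbrakk>x \<in> total; y \<in> total; P x; P y\<rbrakk> \<Longrightarrow> P (x + y)"
  shows "P x"
proof -
  have "x \<in> span (\<Union>g. V g)"
    using assms(1) by (simp add: total_def)
  then have "x \<in> total \<and> P x"
  proof (induction rule: span_induct_alt)
    case base
    then show ?case using assms(2) subspace_0[OF subspace_total] by simp
  next
    case (step c x y)
    then obtain g where "scale c x \<in> V g"
      by (auto intro: subspace_scale[OF subspace_component])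
    then show ?case
      using step assms(3,4) component_total subspace_add[OF subspace_total] by blast
  qed
  then show ?thesis ..
qed

lemma exists_linear_projection:
  "\<exists>f. Vector_Spaces.linear scale scale f \<and> (\<forall>x. f x \<in> total) \<and> (\<forall>x\<in>total. f x = x)"
proof -
  interpret vector_space_pair scale scale ..
  show ?thesis
    using linear_exists_left_inverse_on[OF linear_id subspace_total] by auto
qed

text \<open>Any linear projection onto \<open>total\<close> will do. It extends \<open>br x\<close>,
  whose additivity is known only on \<open>total\<close>, to an additive map of the ambient
  type.\<close>

definition proj :: "'v \<Rightarrow> 'v" where
  "proj = (SOME f. Vector_Spaces.linear scale scale f \<and> (\<forall>x. f x \<in> total) \<and> (\<forall>x\<in>total. f x = x))"

lemma linear_proj: "Vector_Spaces.linear scale scale proj"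
  and proj_total: "proj x \<in> total"
  and proj_id: "x \<in> total \<Longrightarrow> proj x = x"
  using someI_ex[OF exists_linear_projection, folded proj_def] by auto

lemma proj_add: "proj (x + y) = proj x + proj y"
  and proj_scale: "proj (scale c x) = scale c (proj x)"
proof -
  interpret Vector_Spaces.linear scale scale proj
    by (rule linear_proj)
  show "proj (x + y) = proj x + proj y" "proj (scale c x) = scale c (proj x)"
    by (simp_all add: add scale)
qed

end

context lie_color_algebra
begin

lemma zero_total: "0 \<in> total"
  by (rule subspace_0[OF subspace_total])

lemma br_0_left: "y \<in> total \<Longrightarrow> br 0 y = 0"
  using br_scale_left[of 0 y 0] by (simp add: zero_total)

lemma br_0_right: "x \<in> total \<Longrightarrow> br x 0 = 0"
  using br_scale_right[of x 0 0] by (simp add: zero_total)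

lemma br_total:
  assumes "x \<in> total" "y \<in> total" shows "br x y \<in> total"
  using assms(1)
proof (induction rule: total_induct)
  case zero
  then show ?case by (simp add: br_0_left assms(2) zero_total)
next
  case x: (homogeneous g x)
  show ?case
    using assms(2)
  proof (induction rule: total_induct)
    case zero
    then show ?case by (simp add: br_0_right component_total[OF x] zero_total)
  next
    case (homogeneous h y)
    then show ?case using br_degree[OF x] component_total by blast
  next
    case (add y z)
    then show ?case
      by (simp add: br_add_right component_total[OF x] subspace_add[OF subspace_total])
  qed
next
  case (add x z)
  then show ?case
    by (simp add: br_add_left assms(2) subspace_add[OF subspace_total])
qed

lemma funpow_br_total: "x \<in> total \<Longrightarrow> y \<in> total \<Longrightarrow> (br x ^^ n) y \<in> total"
  by (induction n) (auto intro: br_total)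

lemma funpow_br_add:
  assumes "x \<in> total" "y \<in> total" "z \<in> total"
  shows "(br x ^^ n) (y + z) = (br x ^^ n) y + (br x ^^ n) z"
  by (induction n) (simp_all add: assms funpow_br_total br_add_right)

lemma funpow_br_degree: "x \<in> L c \<Longrightarrow> y \<in> L d \<Longrightarrow> (br x ^^ n) y \<in> L (nat_mult n c + d)"
  by (induction n) (auto simp: nat_mult_0 nat_mult_Suc add.assoc dest: br_degree)

text \<open>Skew-symmetry moves \<open>z\<close> to the right in the last two terms of the Jacobi
  identity; all three terms then carry the nonzero factor \<open>eps k i\<close>, which cancels. In
  this form the identity says that \<open>ad\<close> turns brackets into color commutators.\<close>

lemma br_br_homogeneous:
  assumes x: "x \<in> L i" and y: "y \<in> L j" and z: "z \<in> L k"
  shows "br (br x y) z = br x (br y z) - scale (eps i j) (br y (br x z))"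
proof -
  note t = component_total[OF x] component_total[OF y] component_total[OF z]
  have zx: "br z x = - scale (eps k i) (br x z)"
    by (rule br_skew[OF z x])
  have 1: "br y (br z x) = - scale (eps k i) (br y (br x z))"
    using br_scale_right[of y "br x z" "- eps k i"] t by (simp add: zx br_total)
  have 2: "br z (br x y) = - scale (eps k i * eps k j) (br (br x y) z)"
    using br_skew[OF z br_degree[OF x y]] by (simp add: eps_add_right)
  have jk: "eps j k * (eps k i * eps k j) = eps k i"
    using eps_commute[of j k] by (simp add: algebra_simps)
  have "scale (eps k i) (br x (br y z) - scale (eps i j) (br y (br x z)) - br (br x y) z) = 0"
    using br_jacobi[OF x y z] unfolding 1 2
    by (simp add: scale_right_diff_distrib jk mult.commute)
  then show ?thesis
    using eps_nonzero by simp
qed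

lemma br_br_total:
  assumes x: "x \<in> L i" and y: "y \<in> L j" and "z \<in> total"
  shows "br (br x y) z = br x (br y z) - scale (eps i j) (br y (br x z))"
  using assms(3)
proof (induction rule: total_induct)
  case zero
  then show ?case
    by (simp add: br_0_right component_total[OF x] component_total[OF y] br_total)
next
  case (homogeneous k z)
  then show ?case by (rule br_br_homogeneous[OF x y])
next
  case (add z w)
  then show ?case
    by (simp add: br_add_right component_total[OF x] component_total[OF y] br_total
        scale_right_distrib)
qed

section \<open>Adjoint operators and scalars as elements of one ring\<close>

definition ad :: "'v \<Rightarrow> ('k, 'v) endo" where
  "ad x = Endo (\<lambda>(c, v). (0, br x (proj v)))"

text \<open>Scalars act on the auxiliary factor \<open>'k\<close> as well, so that
  \<open>smul 1\<close> is the identity of the ring and the characteristic of the field passes to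
  the ring of operators.\<close>

definition smul :: "'k \<Rightarrow> ('k, 'v) endo" where
  "smul a = Endo (\<lambda>(c, v). (a * c, scale a v))"

lemma ad_apply: "x \<in> total \<Longrightarrow> endo_apply (ad x) (c, v) = (0, br x (proj v))"
  unfolding ad_def by (subst Endo_inverse) (auto simp: proj_add proj_total br_add_right)

lemma smul_apply: "endo_apply (smul a) (c, v) = (a * c, scale a v)"
  unfolding smul_def
  by (subst Endo_inverse) (auto simp: distrib_left scale_right_distrib)

lemmas operator_simps = endo_rep_eqs ad_apply smul_apply proj_add proj_scale proj_id proj_total
  br_total

lemma smul_mult: "smul (a * b) = smul a * smul b"
  by (rule endo_eqI) (simp add: operator_simps)

lemma smul_1: "smul 1 = 1"
  by (rule endo_eqI) (simp add: operator_simps)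

lemma smul_power: "smul (a ^ n) = smul a ^ n"
  by (induction n) (simp_all add: smul_1 smul_mult)

lemma smul_of_nat: "smul (of_nat n) = of_nat n"
proof (induction n)
  case 0
  show ?case by (rule endo_eqI) (simp add: operator_simps zero_prod_def)
next
  case (Suc n)
  have "smul (1 + of_nat n) = smul 1 + smul (of_nat n)"
    by (rule endo_eqI) (simp add: operator_simps distrib_right scale_left_distrib)
  then show ?case by (simp add: Suc.IH smul_1)
qed

lemma of_nat_endo_eq_0: "of_nat n = (0::'k) \<Longrightarrow> of_nat n = (0 :: ('k, 'v) endo)"
  using smul_of_nat[of n] smul_of_nat[of 0] by simp

lemma smul_ad_commute: "x \<in> total \<Longrightarrow> smul a * ad x = ad x * smul a"
  by (rule endo_eqI) (simp add: operator_simps br_scale_right)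

lemma ad_add: "x \<in> total \<Longrightarrow> y \<in> total \<Longrightarrow> ad (x + y) = ad x + ad y"
  by (rule endo_eqI) (simp add: operator_simps subspace_add[OF subspace_total] br_add_left)

lemma ad_0: "ad 0 = 0"
  by (rule endo_eqI) (simp add: operator_simps zero_total br_0_left zero_prod_def)

lemma ad_scale: "x \<in> total \<Longrightarrow> ad (scale a x) = smul a * ad x"
  by (rule endo_eqI) (simp add: operator_simps subspace_scale[OF subspace_total] br_scale_left)

lemma ad_sum:
  assumes "\<And>i. i \<in> I \<Longrightarrow> f i \<in> total"
  shows "ad (\<Sum>i\<in>I. f i) = (\<Sum>i\<in>I. ad (f i))"
  using assms
  by (induction I rule: infinite_finite_induct)
     (auto simp: ad_0 ad_add subspace_sum[OF subspace_total])

lemma ad_br: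
  assumes x: "x \<in> L i" and y: "y \<in> L j"
  shows "ad (br x y) = ad x * ad y - smul (eps i j) * ad y * ad x"
  by (rule endo_eqI)
    (simp add: operator_simps component_total[OF x] component_total[OF y] br_br_total[OF x y])

lemma ad_power_apply:
  "x \<in> total \<Longrightarrow> v \<in> total \<Longrightarrow> endo_apply (ad x ^ n) (0, v) = (0, (br x ^^ n) v)"
  by (induction n) (simp_all add: operator_simps funpow_br_total)

text \<open>The innermost factor \<open>ad x\<close> sends every pair to \<open>(0, v)\<close> with
  \<open>v\<close> in \<open>total\<close>, so for positive \<open>n\<close> the power is determined
  by its action on \<open>total\<close>. For \<open>n = 0\<close> it would be the identity, which
  does not kill the factor \<open>'k\<close>.\<close>

lemma ad_eq_power_iff:
  assumes "w \<in> total" "x \<in> total" "0 < n"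
  shows "ad w = ad x ^ n \<longleftrightarrow> (\<forall>v\<in>total. br w v = (br x ^^ n) v)" (is "?l = ?r")
proof
  assume ?l
  show ?r
  proof
    fix v assume "v \<in> total"
    then show "br w v = (br x ^^ n) v"
      using ad_power_apply[OF assms(2), of v n] ad_apply[OF assms(1), of 0 v]
      by (simp add: \<open>?l\<close>[symmetric] proj_id)
  qed
next
  assume r: ?r
  obtain m where n: "n = Suc m"
    using assms(3) gr0_conv_Suc by blast
  show ?l
  proof (rule endo_eqI)
    fix c v
    have "endo_apply (ad x ^ n) (c, v) = endo_apply (ad x ^ m) (0, br x (proj v))"
      unfolding n power_Suc2 by (simp add: operator_simps assms(2))
    also have "\<dots> = (0, (br x ^^ n) (proj v))"
      by (simp add: ad_power_apply assms(2) br_total proj_total n funpow_swap1)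
    finally show "endo_apply (ad w) (c, v) = endo_apply (ad x ^ n) (c, v)"
      using r by (simp add: operator_simps assms(1))
  qed
qed

text \<open>Since \<open>eps c c = 1\<close>, applying \<open>br x\<close> with \<open>x\<close> of
  degree \<open>c\<close> does not change the twist against \<open>x\<close>: the same
  \<open>q = eps c d\<close> serves at every step of an iteration.\<close>

lemma eps_even:
  "c \<in> even_degrees eps \<Longrightarrow> eps c (nat_mult n c + d) = eps c d"
  by (simp add: even_degrees_def eps_add_right eps_nat_mult_right)

lemma ad_funpow_br:
  assumes p: "prime p" "of_nat p = (0::'k)" and c: "c \<in> even_degrees eps"
    and x: "x \<in> L c" and y: "y \<in> L d"
  shows "ad ((br x ^^ p) y) = ad x ^ p * ad y - smul (eps c d ^ p) * ad y * ad x ^ p"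
proof -
  note t = component_total[OF x] component_total[OF y]
  have "ad ((br x ^^ n) y) = ((\<lambda>u. ad x * u - smul (eps c d) * u * ad x) ^^ n) (ad y)" for n
  proof (induction n)
    case (Suc n)
    then show ?case
      using ad_br[OF x funpow_br_degree[OF x y, of n]] by (simp add: eps_even[OF c])
  qed simp
  then show ?thesis
    using twisted_commutator_prime[OF p(1) of_nat_endo_eq_0[OF p(2)], of "smul (eps c d)" "ad x" "ad y"]
    by (simp add: smul_ad_commute t smul_power)
qed

text \<open>The twisted commutator of \<open>ad x ^ p\<close> and \<open>ad y\<close>, applied to
  \<open>z\<close>. As \<open>eps c d ^ p\<close> is the twist of the degree
  \<open>nat_mult p c\<close> against \<open>d\<close>, the \<open>p\<close>-th power of
  \<open>ad x\<close> behaves as a color derivation of that degree.\<close>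

lemma funpow_br_leibniz:
  assumes p: "prime p" "of_nat p = (0::'k)" and c: "c \<in> even_degrees eps"
    and x: "x \<in> L c" and y: "y \<in> L d" and z: "z \<in> total"
  shows "(br x ^^ p) (br y z) =
    br ((br x ^^ p) y) z + scale (eps c d ^ p) (br y ((br x ^^ p) z))"
proof -
  note t = component_total[OF x] component_total[OF y]
  have "endo_apply (ad ((br x ^^ p) y)) (0, z) =
      endo_apply (ad x ^ p * ad y - smul (eps c d ^ p) * ad y * ad x ^ p) (0, z)"
    by (simp add: ad_funpow_br[OF assms(1-5)])
  then have "br ((br x ^^ p) y) z =
      (br x ^^ p) (br y z) - scale (eps c d ^ p) (br y ((br x ^^ p) z))"
    by (simp add: operator_simps t z funpow_br_total ad_power_apply)
  then show ?thesis by simp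
qed

section \<open>Jacobson's formula for adjoint operators\<close>

lemma coeff_poly_bilinear_pencil:
  assumes x: "x \<in> total" and y: "y \<in> total" and g: "\<And>n. coeff g n \<in> total"
  shows "coeff (poly_bilinear br [:y, x:] g) n =
    br y (coeff g n) + (if n = 0 then 0 else br x (coeff g (n - 1)))"
proof -
  have inner: "(\<Sum>j\<le>degree g. coeff (monom (br a (coeff g j)) (i + j)) n) =
      (if i \<le> n then br a (coeff g (n - i)) else 0)" if a: "a \<in> total" for a i
  proof -
    have "(\<Sum>j\<le>degree g. coeff (monom (br a (coeff g j)) (i + j)) n) =
      (\<Sum>j\<le>degree g. if j = n - i then (if i \<le> n then br a (coeff g j) else 0) else 0)"
      by (rule sum.cong) (auto simp: coeff_monom)
    also have "\<dots> = (if i \<le> n then br a (coeff g (n - i)) else 0)"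
      by (auto simp: sum.delta' coeff_eq_0 br_0_right a)
    finally show ?thesis .
  qed
  have "coeff (poly_bilinear br [:y, x:] g) n = (\<Sum>i\<le>degree [:y, x:].
      \<Sum>j\<le>degree g. coeff (monom (br (coeff [:y, x:] i) (coeff g j)) (i + j)) n)"
    by (simp add: poly_bilinear_def coeff_sum)
  \<comment> \<open>\<open>degree [:y, x:]\<close> is 0 if \<open>x = 0\<close>; the additional term
    of index 1 is then zero.\<close>
  also have "\<dots> = (\<Sum>i\<le>1.
      \<Sum>j\<le>degree g. coeff (monom (br (coeff [:y, x:] i) (coeff g j)) (i + j)) n)"
    by (rule sum.mono_neutral_left) (auto simp: coeff_eq_0 br_0_left g split: if_splits)
  also have "\<dots> = br y (coeff g n) + (if 1 \<le> n then br x (coeff g (n - 1)) else 0)"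
    using inner[OF y, of 0] inner[OF x, of 1]
    by (simp only: atMost_Suc atMost_0 One_nat_def) (simp add: add.commute del: coeff_monom)
  finally show ?thesis by (auto simp: Suc_le_eq)
qed

text \<open>The bracket with \<open>y + Z x\<close> on polynomials corresponds under
  \<open>ad\<close> to the commutator with the pencil \<open>C\<close> on power series. The
  commutators are untwisted because all degrees are multiples of the even degree \<open>c\<close>;
  the degrees are tracked in the same induction, as \<open>ad_br\<close> needs them.\<close>

lemma coeff_pencil_funpow:
  assumes c: "c \<in> even_degrees eps" and x: "x \<in> L c" and y: "y \<in> L c"
  defines "C \<equiv> fps_const (ad y) + fps_X * fps_const (ad x)"
  shows "coeff ((poly_bilinear br [:y, x:] ^^ n) [:x:]) i \<in> L (nat_mult (Suc n) c)"
    and "ad (coeff ((poly_bilinear br [:y, x:] ^^ n) [:x:]) i) =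
      fps_nth (((\<lambda>u. C * u - u * C) ^^ n) (fps_const (ad x))) i"
proof -
  note t = component_total[OF x] component_total[OF y]
  define Q where "Q n i = coeff ((poly_bilinear br [:y, x:] ^^ n) [:x:]) i" for n i
  define U where "U n = ((\<lambda>u. C * u - u * C) ^^ n) (fps_const (ad x))" for n
  have zero_L: "0 \<in> L d" for d
    by (rule subspace_0[OF subspace_component])
  have commutator: "ad (br z w) = ad z * ad w - ad w * ad z"
    if "z \<in> L c" "w \<in> L (nat_mult m c)" for z w m
    using ad_br[OF that] c by (simp add: eps_nat_mult_right even_degrees_def smul_1)
  have "(\<forall>i. Q n i \<in> L (nat_mult (Suc n) c)) \<and> (\<forall>i. ad (Q n i) = fps_nth (U n) i)"
  proof (induction n)
    case 0
    show ?case
      by (auto simp: Q_def U_def coeff_pCons zero_L x nat_mult_0 nat_mult_Suc ad_0 split: nat.split)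
  next
    case (Suc n)
    then have Q_L: "Q n i \<in> L (nat_mult (Suc n) c)" and Q_U: "ad (Q n i) = fps_nth (U n) i" for i
      by auto
    note Q_t = component_total[OF Q_L]
    have Q_Suc: "Q (Suc n) i = br y (Q n i) + (if i = 0 then 0 else br x (Q n (i - 1)))" for i
      using coeff_poly_bilinear_pencil[OF t Q_t[unfolded Q_def], of i] by (simp add: Q_def)
    have br_L: "br z (Q n i) \<in> L (nat_mult (Suc (Suc n)) c)" if "z \<in> L c" for z i
      using br_degree[OF that Q_L] by (simp add: nat_mult_Suc)
    have "Q (Suc n) i \<in> L (nat_mult (Suc (Suc n)) c)" for i
      unfolding Q_Suc by (auto intro!: subspace_add[OF subspace_component] br_L x y zero_L)
    moreover have "ad (Q (Suc n) i) = fps_nth (U (Suc n)) i" for i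
    proof -
      have "fps_nth (U (Suc n)) i = fps_nth (C * U n) i - fps_nth (U n * C) i"
        by (simp add: U_def)
      also have "\<dots> = (ad y * ad (Q n i) - ad (Q n i) * ad y) +
          (if i = 0 then 0 else ad x * ad (Q n (i - 1)) - ad (Q n (i - 1)) * ad x)"
        unfolding C_def pencil_mult_nth Q_U by simp
      also have "\<dots> = ad (br y (Q n i)) + (if i = 0 then 0 else ad (br x (Q n (i - 1))))"
        using commutator[OF y Q_L] commutator[OF x Q_L] by simp
      also have "\<dots> = ad (Q (Suc n) i)"
        unfolding Q_Suc by (simp add: ad_add br_total t Q_t)
      finally show ?thesis by simp
    qed
    ultimately show ?case by blast
  qed
  then show "coeff ((poly_bilinear br [:y, x:] ^^ n) [:x:]) i \<in> L (nat_mult (Suc n) c)"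
    and "ad (coeff ((poly_bilinear br [:y, x:] ^^ n) [:x:]) i) =
      fps_nth (((\<lambda>u. C * u - u * C) ^^ n) (fps_const (ad x))) i"
    by (simp_all add: Q_def U_def)
qed

lemma lie_s_degree:
  assumes "c \<in> even_degrees eps" "x \<in> L c" "y \<in> L c" "0 < p"
  shows "lie_s scale br p i x y \<in> L (nat_mult p c)"
  using coeff_pencil_funpow(1)[OF assms(1-3), of "p - 1"] assms(4)
  by (auto simp: lie_s_def intro: subspace_scale[OF subspace_component])

text \<open>In \<open>C ^ p\<close> with \<open>C = ad y + X ad x\<close> the extreme coefficients
  are \<open>ad y ^ p\<close> and \<open>ad x ^ p\<close>, the inner ones are the operators of the
  \<open>s_i\<close>, and the sum of all coefficients is \<open>(ad x + ad y) ^ p\<close>.\<close>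

lemma ad_add_power:
  assumes p: "prime p" "CHAR('k) = p" and c: "c \<in> even_degrees eps"
    and x: "x \<in> L c" and y: "y \<in> L c"
  shows "ad (x + y) ^ p = ad x ^ p + ad y ^ p + (\<Sum>i = 1..p - 1. ad (lie_s scale br p i x y))"
proof -
  note t = component_total[OF x] component_total[OF y]
  define C where "C = fps_const (ad y) + fps_X * fps_const (ad x)"
  have p0: "of_nat p = (0::'k)"
    using p(2) of_nat_CHAR by blast
  have "1 < p"
    using prime_gt_1_nat[OF p(1)] .
  have coeff: "ad (lie_s scale br p i x y) = fps_nth (C ^ p) i" if i: "i \<in> {1..p - 1}" for i
  proof -
    \<comment> \<open>\<open>i\<close> is invertible because \<open>0 < i < p\<close>, so the factor
      \<open>i\<close> in \<open>jacobson_coeff\<close> cancels against the inverse in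
      \<open>lie_s\<close>.\<close>
    have "of_nat i \<noteq> (0::'k)"
      using i p(2) \<open>1 < p\<close> by (auto simp: of_nat_eq_0_iff_char_dvd dest: dvd_imp_le)
    then have unit: "smul (inverse (of_nat i)) * of_nat i = 1"
      by (simp add: smul_1 flip: smul_of_nat smul_mult)
    have "ad (lie_s scale br p i x y) = smul (inverse (of_nat i)) *
        ad (coeff ((poly_bilinear br [:y, x:] ^^ (p - 1)) [:x:]) (i - 1))"
      unfolding lie_s_def
      by (rule ad_scale[OF component_total[OF coeff_pencil_funpow(1)[OF c x y]]])
    also have "ad (coeff ((poly_bilinear br [:y, x:] ^^ (p - 1)) [:x:]) (i - 1))
        = of_nat i * fps_nth (C ^ p) i"
      using i jacobson_coeff[OF p(1) of_nat_endo_eq_0[OF p0], of i "ad y" "ad x"]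
      by (simp add: coeff_pencil_funpow(2)[OF c x y] C_def)
    finally show ?thesis
      by (simp add: unit flip: mult.assoc)
  qed
  have "{..p} = insert 0 (insert p {1..p - 1})"
    using \<open>1 < p\<close> by auto
  then have "(\<Sum>i\<le>p. fps_nth (C ^ p) i) =
      fps_nth (C ^ p) 0 + (fps_nth (C ^ p) p + (\<Sum>i = 1..p - 1. fps_nth (C ^ p) i))"
    using \<open>1 < p\<close> by simp
  then show ?thesis
    using coeff by (simp add: C_def pencil_power_nth ad_add t add_ac)
qed

section \<open>Existence and uniqueness of the p-map\<close>

text \<open>These are the conditions that the degree axiom and the \<open>ad\<close> axiom impose on
  a value \<open>w\<close> of the p-map at \<open>x\<close>; with a faithful adjoint action they
  leave at most one candidate.\<close>

definition is_p_power :: "nat \<Rightarrow> 'g \<Rightarrow> 'v \<Rightarrow> 'v \<Rightarrow> bool" where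
  "is_p_power p c x w \<longleftrightarrow> w \<in> L (nat_mult p c) \<and> (\<forall>v\<in>total. br w v = (br x ^^ p) v)"

lemma is_p_power_iff_ad:
  assumes "x \<in> L c" "0 < p"
  shows "is_p_power p c x w \<longleftrightarrow> w \<in> L (nat_mult p c) \<and> ad w = ad x ^ p"
  using ad_eq_power_iff[OF _ component_total[OF assms(1)] assms(2)] component_total
  by (auto simp: is_p_power_def)

lemma is_p_power_add:
  assumes p: "prime p" "CHAR('k) = p" and c: "c \<in> even_degrees eps"
    and x: "x \<in> L c" and y: "y \<in> L c"
    and xw: "is_p_power p c x w" and yw: "is_p_power p c y w'"
  shows "is_p_power p c (x + y) (w + w' + (\<Sum>i = 1..p - 1. lie_s scale br p i x y))"
proof -
  have "0 < p" using prime_gt_0_nat[OF p(1)] .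
  note s = lie_s_degree[OF c x y \<open>0 < p\<close>]
  note sub = subspace_component[of "nat_mult p c"]
  have w: "w \<in> L (nat_mult p c)" "ad w = ad x ^ p" and w': "w' \<in> L (nat_mult p c)" "ad w' = ad y ^ p"
    using xw yw by (simp_all add: is_p_power_iff_ad[OF x \<open>0 < p\<close>] is_p_power_iff_ad[OF y \<open>0 < p\<close>])
  have sum: "(\<Sum>i = 1..p - 1. lie_s scale br p i x y) \<in> L (nat_mult p c)"
    by (rule subspace_sum[OF sub]) (rule s)
  have "ad (w + w' + (\<Sum>i = 1..p - 1. lie_s scale br p i x y)) = ad (x + y) ^ p"
    using component_total[OF subspace_add[OF sub w(1) w'(1)]] component_total[OF sum]
      component_total[OF w(1)] component_total[OF w'(1)] component_total[OF s]
    by (simp add: ad_add ad_sum w w' ad_add_power[OF p c x y])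
  then show ?thesis
    using subspace_add[OF sub subspace_add[OF sub w(1) w'(1)] sum]
    by (simp add: is_p_power_iff_ad[OF subspace_add[OF subspace_component x y] \<open>0 < p\<close>])
qed

lemma is_p_power_scale:
  assumes "0 < p" and x: "x \<in> L c" and xw: "is_p_power p c x w"
  shows "is_p_power p c (scale a x) (scale (a ^ p) w)"
proof -
  have w: "w \<in> L (nat_mult p c)" "ad w = ad x ^ p"
    using xw by (simp_all add: is_p_power_iff_ad[OF x \<open>0 < p\<close>])
  have "(smul a * ad x) ^ n = smul a ^ n * ad x ^ n" for n
    using component_total[OF x] by (induction n)
      (simp_all add: mult.assoc smul_power[symmetric] smul_ad_commute,
       metis (no_types, opaque_lifting) mult.assoc power_commuting_commutes smul_ad_commute smul_power)
  then have "ad (scale (a ^ p) w) = ad (scale a x) ^ p"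
    using component_total[OF x] component_total[OF w(1)] by (simp add: ad_scale w(2) smul_power)
  then show ?thesis
    using subspace_scale[OF subspace_component w(1)]
    by (simp add: is_p_power_iff_ad[OF subspace_scale[OF subspace_component x] \<open>0 < p\<close>])
qed

text \<open>Two candidates for a value differ by an element of a single component, so faithfulness
  on homogeneous elements makes the choice by \<open>SOME\<close> unique. The second fact obtained
  identifies the p-map wherever a p-th power is already known.\<close>

lemma restricted_of_inner_powers:
  assumes p: "prime p" "CHAR('k) = p"
    and faithful: "\<And>d w. \<lbrakk>w \<in> L d; \<And>v. v \<in> total \<Longrightarrow> br w v = 0\<rbrakk> \<Longrightarrow> w = 0"
    and powers: "\<And>c x. \<lbrakk>c \<in> even_degrees eps; x \<in> L c\<rbrakk> \<Longrightarrow> \<exists>w. is_p_power p c x w"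
  obtains pm where "restricted_lie_color_algebra scale L eps br p pm"
    and "\<And>c x w. \<lbrakk>c \<in> even_degrees eps; x \<in> L c; is_p_power p c x w\<rbrakk> \<Longrightarrow> pm c x = w"
proof
  define pm where "pm c x = (SOME w. is_p_power p c x w)" for c x
  have "0 < p" using prime_gt_0_nat[OF p(1)] .
  have unique: "w = w'" if "is_p_power p c x w" "is_p_power p c x w'" for c x w w'
  proof -
    have diff: "w - w' \<in> L (nat_mult p c)"
      using that by (auto simp: is_p_power_def intro: subspace_diff[OF subspace_component])
    have "br (w - w') v = 0" if v: "v \<in> total" for v
      using \<open>is_p_power p c x w\<close> \<open>is_p_power p c x w'\<close> v component_total
        br_add_left[of "w - w'" w' v] component_total[OF diff]
      by (auto simp: is_p_power_def)
    then show ?thesis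
      using faithful[OF diff] by simp
  qed
  have pm: "is_p_power p c x (pm c x)" if "c \<in> even_degrees eps" "x \<in> L c" for c x
    unfolding pm_def by (rule someI_ex[OF powers[OF that]])
  show eq: "pm c x = w" if "c \<in> even_degrees eps" "x \<in> L c" "is_p_power p c x w" for c x w
    using unique[OF pm[OF that(1,2)] that(3)] .
  show "restricted_lie_color_algebra scale L eps br p pm"
  proof unfold_locales
    fix c x assume c: "c \<in> even_degrees eps" and x: "x \<in> L c"
    show "pm c x \<in> L (nat_mult p c)"
      using pm[OF c x] by (simp add: is_p_power_def)
    show "pm c (scale a x) = scale (a ^ p) (pm c x)" for a
      using eq[OF c subspace_scale[OF subspace_component x]] is_p_power_scale[OF \<open>0 < p\<close> x pm[OF c x]]
      by blast
    show "br (pm c x) y = (br x ^^ p) y" if "y \<in> total" for y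
      using pm[OF c x] that by (simp add: is_p_power_def)
    show "pm c (x + y) = pm c x + pm c y + (\<Sum>i = 1..p - 1. lie_s scale br p i x y)"
      if y: "y \<in> L c" for y
      using eq[OF c subspace_add[OF subspace_component x y]]
        is_p_power_add[OF p c x y pm[OF c x] pm[OF c y]] by blast
  qed
qed

end

section \<open>The Lie color algebra of a triple system and its derivations\<close>

context graded_space
begin

text \<open>Two families with the same sum are compared on the union of their supports, where
  independence makes the difference vanish; this gives the uniqueness demanded by
  \<open>THE\<close>.\<close>

lemma components_eqI:
  assumes "finite {g. f g \<noteq> 0}" "\<And>g. f g \<in> V g" "x = (\<Sum>g | f g \<noteq> 0. f g)"
  shows "components V x = f"
  unfolding components_def
proof (rule the_equality)
  show "finite {g. f g \<noteq> 0} \<and> (\<forall>g. f g \<in> V g) \<and> x = (\<Sum>g | f g \<noteq> 0. f g)"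
    using assms by blast
next
  fix f' assume f': "finite {g. f' g \<noteq> 0} \<and> (\<forall>g. f' g \<in> V g) \<and> x = (\<Sum>g | f' g \<noteq> 0. f' g)"
  define I where "I = {g. f g \<noteq> 0} \<union> {g. f' g \<noteq> 0}"
  have "finite I" using assms(1) f' by (simp add: I_def)
  have "(\<Sum>g\<in>I. f g) = x" "(\<Sum>g\<in>I. f' g) = x"
  proof -
    have "(\<Sum>g\<in>I. f g) = (\<Sum>g | f g \<noteq> 0. f g)"
      by (rule sum.mono_neutral_right[OF \<open>finite I\<close>]) (auto simp: I_def)
    then show "(\<Sum>g\<in>I. f g) = x" by (simp only: assms(3))
    have "(\<Sum>g\<in>I. f' g) = (\<Sum>g | f' g \<noteq> 0. f' g)"
      by (rule sum.mono_neutral_right[OF \<open>finite I\<close>]) (auto simp: I_def)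
    then show "(\<Sum>g\<in>I. f' g) = x" using f' by simp
  qed
  then have sum: "(\<Sum>g\<in>I. f' g - f g) = 0"
    by (simp add: sum_subtractf)
  have "f' g - f g = 0" if "g \<in> I" for g
    using independent_components[OF \<open>finite I\<close> _ sum that] assms(2) f'
    by (simp add: subspace_diff[OF subspace_component])
  then show "f' = f"
    by (force simp: I_def)
qed

lemma
  assumes "x \<in> total"
  shows finite_degrees: "finite (degrees V x)"
    and components_mem: "components V x g \<in> V g"
    and sum_components: "(\<Sum>g\<in>degrees V x. components V x g) = x"
proof -
  let ?P = "\<lambda>f x. finite {g. f g \<noteq> 0} \<and> (\<forall>g. f g \<in> V g) \<and> x = (\<Sum>g | f g \<noteq> 0. f g)"
  have "\<exists>f. ?P f x"
    using assms
  proof (induction rule: total_induct)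
    case zero
    show ?case
      by (rule exI[of _ "\<lambda>_. 0"]) (simp add: subspace_0[OF subspace_component])
  next
    case (homogeneous g x)
    then show ?case
      by (cases "x = 0"; intro exI[of _ "\<lambda>h. if h = g then x else 0"])
         (auto simp: subspace_0[OF subspace_component] if_distrib cong: if_cong)
  next
    case (add x y)
    then obtain f h where f: "?P f x" and h: "?P h y" by blast
    let ?I = "{g. f g \<noteq> 0} \<union> {g. h g \<noteq> 0}"
    have fin: "finite ?I" using f h by simp
    have sub: "{g. f g + h g \<noteq> 0} \<subseteq> ?I" by auto
    have "(\<Sum>g | f g + h g \<noteq> 0. f g + h g) = (\<Sum>g\<in>?I. f g + h g)"
      by (rule sum.mono_neutral_left[OF fin sub]) auto
    also have "\<dots> = (\<Sum>g | f g \<noteq> 0. f g) + (\<Sum>g | h g \<noteq> 0. h g)"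
      unfolding sum.distrib using f h
      by (intro arg_cong2[where f = "(+)"] sum.mono_neutral_right) auto
    finally have "x + y = (\<Sum>g | f g + h g \<noteq> 0. f g + h g)"
      using f h by simp
    then show ?case
      using f h finite_subset[OF sub fin]
      by (intro exI[of _ "\<lambda>g. f g + h g"]) (auto intro: subspace_add[OF subspace_component])
  qed
  then obtain f where f: "?P f x" by blast
  then have "components V x = f"
    by (intro components_eqI) auto
  then show "finite (degrees V x)" "components V x g \<in> V g"
    "(\<Sum>g\<in>degrees V x. components V x g) = x"
    using f by (auto simp: degrees_def)
qed

lemma components_add:
  assumes "x \<in> total" "y \<in> total"
  shows "components V (x + y) = (\<lambda>g. components V x g + components V y g)"
proof (rule components_eqI)
  let ?I = "degrees V x \<union> degrees V y"
  have fin: "finite ?I" using assms by (simp add: finite_degrees)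
  have sub: "{g. components V x g + components V y g \<noteq> 0} \<subseteq> ?I"
    by (auto simp: degrees_def)
  show "finite {g. components V x g + components V y g \<noteq> 0}"
    by (rule finite_subset[OF sub fin])
  show "components V x g + components V y g \<in> V g" for g
    using assms by (auto intro: subspace_add[OF subspace_component] components_mem)
  have "(\<Sum>g\<in>?I. components V x g) = x" "(\<Sum>g\<in>?I. components V y g) = y"
    by (subst sum_components[symmetric, OF assms(1)] sum_components[symmetric, OF assms(2)],
      rule sum.mono_neutral_right[OF fin]; auto simp: degrees_def)+
  then have "x + y = (\<Sum>g\<in>?I. components V x g + components V y g)"
    by (simp add: sum.distrib)
  also have "\<dots> = (\<Sum>g | components V x g + components V y g \<noteq> 0. components V x g + components V y g)"
    by (rule sum.mono_neutral_right[OF fin sub]) auto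
  finally show "x + y = (\<Sum>g | components V x g + components V y g \<noteq> 0.
    components V x g + components V y g)" .
qed

lemma components_scale:
  assumes "x \<in> total"
  shows "components V (scale c x) = (\<lambda>g. scale c (components V x g))"
proof (rule components_eqI)
  have sub: "{g. scale c (components V x g) \<noteq> 0} \<subseteq> degrees V x"
    by (auto simp: degrees_def)
  show "finite {g. scale c (components V x g) \<noteq> 0}"
    by (rule finite_subset[OF sub finite_degrees[OF assms]])
  show "scale c (components V x g) \<in> V g" for g
    using assms by (auto intro: subspace_scale[OF subspace_component] components_mem)
  have "scale c x = (\<Sum>g\<in>degrees V x. scale c (components V x g))"
    using sum_components[OF assms] by (metis scale_sum_right)
  also have "\<dots> = (\<Sum>g | scale c (components V x g) \<noteq> 0. scale c (components V x g))"
    by (rule sum.mono_neutral_right[OF finite_degrees[OF assms] sub]) auto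
  finally show "scale c x = (\<Sum>g | scale c (components V x g) \<noteq> 0. scale c (components V x g))" .
qed

lemma components_homogeneous:
  assumes "x \<in> V g"
  shows "components V x = (\<lambda>h. if h = g then x else 0)"
  using assms by (cases "x = 0"; intro components_eqI)
    (auto simp: subspace_0[OF subspace_component] if_distrib cong: if_cong)

end

section \<open>Bilinear extension of products twisted by \<open>eps\<close>\<close>

text \<open>Both \<open>eps\<close>-terms of \<open>LD_bracket\<close> have this shape:
  \<open>E(x)\<close> with \<open>\<Phi> a B = B a\<close> on \<open>T\<close> and
  \<open>Der\<close>, and \<open>ED\<close> at a point \<open>z\<close> with
  \<open>\<Phi> A B = B (A z)\<close> on \<open>Der\<close> twice.\<close>

definition eps_sum where
  "eps_sum scale eps V W \<Phi> x y = (\<Sum>i\<in>degrees V x. \<Sum>j\<in>degrees W y.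
    scale (eps i j) (\<Phi> (components V x i) (components W y j)))"

text \<open>Bilinearity is asked only of homogeneous arguments, since an arbitrary self-map
  \<open>B\<close> of \<open>T\<close> need not make \<open>B a\<close> linear in
  \<open>a\<close>.\<close>

locale graded_pairing =
  left: graded_space scaleV V + right: graded_space scaleW W + target: vector_space scale
  for scaleV :: "'k::field \<Rightarrow> 'v::ab_group_add \<Rightarrow> 'v" and V :: "'g::ab_group_add \<Rightarrow> 'v set"
    and scaleW :: "'k \<Rightarrow> 'w::ab_group_add \<Rightarrow> 'w" and W :: "'g \<Rightarrow> 'w set"
    and scale :: "'k \<Rightarrow> 'u::ab_group_add \<Rightarrow> 'u" +
  fixes eps :: "'g \<Rightarrow> 'g \<Rightarrow> 'k" and \<Phi> :: "'v \<Rightarrow> 'w \<Rightarrow> 'u"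
  assumes add_left: "\<lbrakk>a \<in> V i; a' \<in> V i; b \<in> W j\<rbrakk> \<Longrightarrow> \<Phi> (a + a') b = \<Phi> a b + \<Phi> a' b"
    and add_right: "\<lbrakk>a \<in> V i; b \<in> W j; b' \<in> W j\<rbrakk> \<Longrightarrow> \<Phi> a (b + b') = \<Phi> a b + \<Phi> a b'"
    and scale_left: "\<lbrakk>a \<in> V i; b \<in> W j\<rbrakk> \<Longrightarrow> \<Phi> (scaleV c a) b = scale c (\<Phi> a b)"
    and scale_right: "\<lbrakk>a \<in> V i; b \<in> W j\<rbrakk> \<Longrightarrow> \<Phi> a (scaleW c b) = scale c (\<Phi> a b)"
begin

lemma zero_left: "b \<in> W j \<Longrightarrow> \<Phi> 0 b = 0"
  using scale_left[of 0 0 b j 0] by (simp add: left.subspace_0[OF left.subspace_component])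

lemma zero_right: "a \<in> V i \<Longrightarrow> \<Phi> a 0 = 0"
  using scale_right[of a i 0 0 0] by (simp add: right.subspace_0[OF right.subspace_component])

abbreviation "pairing \<equiv> eps_sum scale eps V W \<Phi>"

text \<open>The index sets in \<open>eps_sum\<close> shrink when components cancel; over common
  finite supersets the sums for several arguments can be compared termwise.\<close>

lemma pairing_superset:
  assumes x: "x \<in> left.total" and y: "y \<in> right.total"
    and I: "finite I" "degrees V x \<subseteq> I" and J: "finite J" "degrees W y \<subseteq> J"
  shows "pairing x y =
    (\<Sum>i\<in>I. \<Sum>j\<in>J. scale (eps i j) (\<Phi> (components V x i) (components W y j)))"
proof -
  have "(\<Sum>j\<in>degrees W y. scale (eps i j) (\<Phi> (components V x i) (components W y j)))
      = (\<Sum>j\<in>J. scale (eps i j) (\<Phi> (components V x i) (components W y j)))" for i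
    by (rule sum.mono_neutral_left[OF J])
       (auto simp: degrees_def zero_right[OF left.components_mem[OF x]])
  then have "pairing x y = (\<Sum>i\<in>degrees V x. \<Sum>j\<in>J.
      scale (eps i j) (\<Phi> (components V x i) (components W y j)))"
    by (simp add: eps_sum_def)
  also have "\<dots> = (\<Sum>i\<in>I. \<Sum>j\<in>J. scale (eps i j) (\<Phi> (components V x i) (components W y j)))"
    by (rule sum.mono_neutral_left[OF I])
       (auto simp: degrees_def zero_left[OF right.components_mem[OF y]])
  finally show ?thesis .
qed

lemma pairing_homogeneous:
  assumes "x \<in> V i" "y \<in> W j"
  shows "pairing x y = scale (eps i j) (\<Phi> x y)"
proof -
  have "degrees V x \<subseteq> {i}" "degrees W y \<subseteq> {j}"
    using assms by (auto simp: degrees_def left.components_homogeneous right.components_homogeneous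
        split: if_splits)
  then show ?thesis
    using pairing_superset[of x y "{i}" "{j}"] assms
    by (simp add: left.component_total right.component_total left.components_homogeneous
        right.components_homogeneous)
qed

lemma pairing_add_left:
  assumes x: "x \<in> left.total" and x': "x' \<in> left.total" and y: "y \<in> right.total"
  shows "pairing (x + x') y = pairing x y + pairing x' y"
proof -
  let ?I = "degrees V x \<union> degrees V x'" and ?J = "degrees W y"
  have I: "finite ?I" and J: "finite ?J"
    using assms by (simp_all add: left.finite_degrees right.finite_degrees)
  have sub: "degrees V (x + x') \<subseteq> ?I"
    by (auto simp: degrees_def left.components_add[OF x x'])
  show ?thesis
    using x x' y
    by (simp add: pairing_superset[OF _ _ I _ J] left.subspace_add[OF left.subspace_total] sub
        left.components_add add_left[OF left.components_mem left.components_mem right.components_mem]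
        target.scale_right_distrib sum.distrib)
qed

lemma pairing_add_right:
  assumes x: "x \<in> left.total" and y: "y \<in> right.total" and y': "y' \<in> right.total"
  shows "pairing x (y + y') = pairing x y + pairing x y'"
proof -
  let ?I = "degrees V x" and ?J = "degrees W y \<union> degrees W y'"
  have I: "finite ?I" and J: "finite ?J"
    using assms by (simp_all add: left.finite_degrees right.finite_degrees)
  have sub: "degrees W (y + y') \<subseteq> ?J"
    by (auto simp: degrees_def right.components_add[OF y y'])
  show ?thesis
    using x y y'
    by (simp add: pairing_superset[OF _ _ I _ J] right.subspace_add[OF right.subspace_total] sub
        right.components_add add_right[OF left.components_mem right.components_mem right.components_mem]
        target.scale_right_distrib sum.distrib)
qed

lemma pairing_scale_left:
  assumes x: "x \<in> left.total" and y: "y \<in> right.total"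
  shows "pairing (scaleV c x) y = scale c (pairing x y)"
proof -
  have I: "finite (degrees V x)" and J: "finite (degrees W y)"
    using assms by (simp_all add: left.finite_degrees right.finite_degrees)
  have sub: "degrees V (scaleV c x) \<subseteq> degrees V x"
    by (auto simp: degrees_def left.components_scale[OF x])
  show ?thesis
    using x y
    by (simp add: pairing_superset[OF _ _ I _ J] left.subspace_scale[OF left.subspace_total] sub
        left.components_scale scale_left[OF left.components_mem right.components_mem]
        target.scale_sum_right mult.commute)
qed

lemma pairing_scale_right:
  assumes x: "x \<in> left.total" and y: "y \<in> right.total"
  shows "pairing x (scaleW c y) = scale c (pairing x y)"
proof -
  have I: "finite (degrees V x)" and J: "finite (degrees W y)"
    using assms by (simp_all add: left.finite_degrees right.finite_degrees)
  have sub: "degrees W (scaleW c y) \<subseteq> degrees W y"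
    by (auto simp: degrees_def right.components_scale[OF y])
  show ?thesis
    using x y
    by (simp add: pairing_superset[OF _ _ I _ J] right.subspace_scale[OF right.subspace_total] sub
        right.components_scale scale_right[OF left.components_mem right.components_mem]
        target.scale_sum_right mult.commute)
qed

end

section \<open>Gradings of \<open>Der(T)\<close> and of \<open>L_D(T)\<close>\<close>

context lie_color_triple_system
begin

abbreviation "Der \<equiv> color_der scale T eps br"
abbreviation "fun_scale \<equiv> \<lambda>c (D :: 't \<Rightarrow> 't) z. scale c (D z)"
abbreviation "LD \<equiv> LD_component scale T eps br"
abbreviation "LDbr \<equiv> LD_bracket scale T eps br"

lemma linearD:
  assumes "Vector_Spaces.linear scale scale D"
  shows "D (x + y) = D x + D y" "D (x - y) = D x - D y" "D (- x) = - D x" "D 0 = 0"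
    "D (scale c x) = scale c (D x)"
proof -
  interpret Vector_Spaces.linear scale scale D by (rule assms)
  show "D (x + y) = D x + D y" "D (x - y) = D x - D y" "D (- x) = - D x" "D 0 = 0"
    "D (scale c x) = scale c (D x)"
    by (simp_all add: add diff neg scale zero)
qed

lemmas br_linear = linearD[OF br_linear1] linearD[OF br_linear2] linearD[OF br_linear3]

lemma linearI:
  assumes "\<And>x y. D (x + y) = D x + D y" "\<And>c x. D (scale c x) = scale c (D x)"
  shows "Vector_Spaces.linear scale scale D"
  using assms by unfold_locales auto

lemma Der_linear:
  assumes "D \<in> Der i"
  shows "D (x + y) = D x + D y" "D (x - y) = D x - D y" "D (- x) = - D x" "D 0 = 0"
    "D (scale c x) = scale c (D x)"
  using assms by (auto simp: color_der_def intro: linearD)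

lemma Der_degree: "D \<in> Der i \<Longrightarrow> x \<in> T j \<Longrightarrow> D x \<in> T (i + j)"
  by (auto simp: color_der_def)

lemma Der_leibniz:
  "\<lbrakk>D \<in> Der a; x \<in> T i; y \<in> T j\<rbrakk> \<Longrightarrow> D (br x y z) = br (D x) y z + scale (eps a i) (br x (D y) z)
        + scale (eps a (i + j)) (br x y (D z))"
  by (auto simp: color_der_def)

lemma homogeneous_induct [case_names zero homogeneous add]:
  assumes "P 0" and "\<And>g x. x \<in> T g \<Longrightarrow> P x" and "\<And>x y. P x \<Longrightarrow> P y \<Longrightarrow> P (x + y)"
  shows "P x"
  by (rule total_induct[of x]) (use assms in \<open>auto simp: total_UNIV\<close>)

text \<open>\<open>color_der\<close> asks for the Leibniz rule at arbitrary \<open>z\<close>; both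
  sides are additive in \<open>z\<close>, so homogeneous \<open>z\<close> suffice.\<close>

lemma DerI:
  assumes "Vector_Spaces.linear scale scale D" and "\<And>i x. x \<in> T i \<Longrightarrow> D x \<in> T (a + i)"
    and leibniz: "\<And>i j k x y z. \<lbrakk>x \<in> T i; y \<in> T j; z \<in> T k\<rbrakk> \<Longrightarrow>
      D (br x y z) = br (D x) y z + scale (eps a i) (br x (D y) z)
        + scale (eps a (i + j)) (br x y (D z))"
  shows "D \<in> Der a"
proof -
  have "D (br x y z) = br (D x) y z + scale (eps a i) (br x (D y) z)
        + scale (eps a (i + j)) (br x y (D z))" if "x \<in> T i" "y \<in> T j" for i j x y z
  proof (induction z rule: homogeneous_induct)
    case zero
    then show ?case by (simp add: br_linear linearD[OF assms(1)])
  next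
    case (homogeneous g z)
    then show ?case using leibniz that by blast
  next
    case (add z w)
    then show ?case
      by (simp add: br_linear linearD[OF assms(1)] scale_right_distrib algebra_simps)
  qed
  then show ?thesis
    using assms(1,2) by (auto simp: color_der_def)
qed

lemma vector_space_fun_scale: "vector_space fun_scale"
  by unfold_locales (auto simp: fun_eq_iff scale_right_distrib scale_left_distrib)

lemma graded_space_Der: "graded_space fun_scale Der"
proof -
  interpret maps: vector_space fun_scale by (rule vector_space_fun_scale)
  show ?thesis
  proof
    fix g
    show "maps.subspace (Der g)"
      unfolding maps.subspace_def
    proof (intro conjI ballI allI)
      show "0 \<in> Der g"
        by (rule DerI) (auto intro!: linearI simp: br_linear subspace_0[OF subspace_component])
      show "D + E \<in> Der g" if "D \<in> Der g" "E \<in> Der g" for D E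
        using that
        by (intro DerI) (auto intro!: linearI subspace_add[OF subspace_component]
          simp: Der_linear Der_degree Der_leibniz br_linear scale_right_distrib
            add.assoc[where ?'a = 't] add.commute[where ?'a = 't] add.left_commute[where ?'a = 't])
      show "(\<lambda>z. scale c (D z)) \<in> Der g" if "D \<in> Der g" for c D
        using that
        by (intro DerI) (auto intro!: linearI subspace_scale[OF subspace_component]
          simp: Der_linear Der_degree Der_leibniz br_linear scale_right_distrib mult.commute)
    qed
  next
    fix I f g
    assume I: "finite (I :: 'g set)" and f: "\<And>g. g \<in> I \<Longrightarrow> f g \<in> Der g"
      and sum: "(\<Sum>g\<in>I. f g) = 0" and g: "g \<in> I"
    have "f g x = 0" for x
    proof (induction x rule: homogeneous_induct)
      case (homogeneous c x)
      \<comment> \<open>At a homogeneous \<open>x\<close> of degree \<open>c\<close> the values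
        \<open>f g x\<close> have the pairwise distinct degrees \<open>g + c\<close>, so
        independence in \<open>T\<close> applies after reindexing.\<close>
      have inj: "inj_on (\<lambda>g. g + c) I" by (auto intro: inj_onI)
      have sum_apply: "(\<Sum>g\<in>J. f g) x = (\<Sum>g\<in>J. f g x)" if "finite J" for J
        using that by (induction J) auto
      have 0: "(\<Sum>h\<in>(\<lambda>g. g + c) ` I. f (h - c) x) = 0"
        using fun_cong[OF sum, of x] by (simp add: sum.reindex[OF inj] sum_apply[OF I])
      have "f (g + c - c) x = 0"
        by (rule independent_components[OF _ _ 0])
          (use I g f homogeneous in \<open>auto intro: Der_degree\<close>)
      then show ?case by simp
    qed (simp_all add: Der_linear[OF f[OF g]])
    then show "f g = 0" by (simp add: fun_eq_iff)
  qed
qed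

lemma graded_space_LD: "graded_space (LD_scale scale) LD"
proof -
  interpret der: graded_space fun_scale Der by (rule graded_space_Der)
  interpret pair: vector_space "LD_scale scale"
    by unfold_locales
      (auto simp: LD_scale_def fun_eq_iff scale_right_distrib scale_left_distrib)
  show ?thesis
  proof
    fix g
    show "pair.subspace (LD g)"
      unfolding pair.subspace_def LD_component_def
      by (auto simp: LD_scale_def zero_prod_def intro: subspace_add[OF subspace_component]
          subspace_scale[OF subspace_component] subspace_0[OF subspace_component]
          der.subspace_add[OF der.subspace_component] der.subspace_scale[OF der.subspace_component]
          der.subspace_0[OF der.subspace_component])
  next
    fix I f g
    assume I: "finite (I :: 'g set)" and f: "\<And>g. g \<in> I \<Longrightarrow> f g \<in> LD g"
      and sum: "(\<Sum>g\<in>I. f g) = 0" and g: "g \<in> I"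
    have "fst (f g) = 0"
      by (rule independent_components[OF I _ _ g])
        (use f arg_cong[OF sum, of fst] in \<open>auto simp: LD_component_def fst_sum mem_Times_iff\<close>)
    moreover have "snd (f g) = 0"
      by (rule der.independent_components[OF I _ _ g])
        (use f arg_cong[OF sum, of snd] in \<open>auto simp: LD_component_def snd_sum mem_Times_iff\<close>)
    ultimately show "f g = 0" by (simp add: prod_eq_iff)
  qed
qed

lemma LD_bracket_eq:
  "LDbr (x, D) (y, E) =
    (D y - eps_sum scale eps T Der (\<lambda>a B. B a) x E,
     \<lambda>z. br x y z + D (E z) - eps_sum scale eps Der Der (\<lambda>A B. B (A z)) D E)"
  by (simp add: LD_bracket_def eps_sum_def Let_def)

lemma graded_pairing_apply: "graded_pairing scale T fun_scale Der scale (\<lambda>a B. B a)"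
  by (intro graded_pairing.intro graded_pairing_axioms.intro graded_space_axioms graded_space_Der
      vector_space_axioms) (auto simp: Der_linear)

lemma graded_pairing_comp: "graded_pairing fun_scale Der fun_scale Der scale (\<lambda>A B. B (A z))"
  by (intro graded_pairing.intro graded_pairing_axioms.intro graded_space_axioms graded_space_Der
      vector_space_axioms) (auto simp: Der_linear)

lemma LD_bracket_homogeneous:
  assumes "(a, A) \<in> LD i" "(b, B) \<in> LD j"
  shows "LDbr (a, A) (b, B) = (A b - scale (eps i j) (B a),
    \<lambda>z. br a b z + A (B z) - scale (eps i j) (B (A z)))"
  using assms
  by (simp add: LD_bracket_eq LD_component_def
      graded_pairing.pairing_homogeneous[OF graded_pairing_apply, of _ i _ j]
      graded_pairing.pairing_homogeneous[OF graded_pairing_comp, of _ i _ j])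

section \<open>Lie color algebra axioms for \<open>L_D(T)\<close>\<close>

lemma br_skew':
  assumes x: "x \<in> T i" and y: "y \<in> T j"
  shows "br x y z = - scale (eps i j) (br y x z)"
proof (induction z rule: homogeneous_induct)
  case zero
  show ?case by (simp add: br_linear)
next
  case (homogeneous g z)
  then show ?case by (rule br_skew[OF x y])
next
  case (add z w)
  have "br x y (z + w) = br x y z + br x y w"
    by (simp add: br_linear)
  also have "\<dots> = - scale (eps i j) (br y x (z + w))"
    unfolding add.IH by (simp add: br_linear scale_right_distrib)
  finally show ?case .
qed

lemma inner_Der:
  assumes "x \<in> T i" "y \<in> T j"
  shows "br x y \<in> Der (i + j)"
  by (rule DerI[OF br_linear3]) (rule br_degree[OF assms] br_derivation[OF assms], assumption+)+

lemma comp_Der: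
  assumes A: "A \<in> Der i" and B: "B \<in> Der j"
  shows "(\<lambda>z. A (B z) - scale (eps i j) (B (A z))) \<in> Der (i + j)"
proof (rule DerI)
  show "Vector_Spaces.linear scale scale (\<lambda>z. A (B z) - scale (eps i j) (B (A z)))"
    by (rule linearI) (auto simp: Der_linear[OF A] Der_linear[OF B] scale_right_distrib
        scale_right_diff_distrib mult.commute)
next
  fix k x assume x: "x \<in> T k"
  show "A (B x) - scale (eps i j) (B (A x)) \<in> T (i + j + k)"
    using Der_degree[OF A Der_degree[OF B x]] Der_degree[OF B Der_degree[OF A x]]
    by (auto intro!: subspace_diff[OF subspace_component] subspace_scale[OF subspace_component]
        simp: add_ac)
next
  fix k l m x y z assume x: "x \<in> T k" and y: "y \<in> T l" and z: "z \<in> T m"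
  \<comment> \<open>Naming the \<open>eps\<close> values turns the scalars into commuting atoms,
    with \<open>p1 * p2 = 1\<close> as the relation that makes the mixed terms cancel.\<close>
  define p1 p2 q1 q2 r1 r2 where "p1 = eps i j" "p2 = eps j i" "q1 = eps i k" "q2 = eps j k"
    "r1 = eps i l" "r2 = eps j l"
  have p: "p1 * p2 = 1" "p1 * (p2 * w) = w" for w
    using eps_commute[of i j] by (simp_all add: p1_p2_q1_q2_r1_r2_def flip: mult.assoc)
  show "A (B (br x y z)) - scale (eps i j) (B (A (br x y z))) =
      br (A (B x) - scale (eps i j) (B (A x))) y z
      + scale (eps (i + j) k) (br x (A (B y) - scale (eps i j) (B (A y))) z)
      + scale (eps (i + j) (k + l)) (br x y (A (B z) - scale (eps i j) (B (A z))))"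
    by (simp add: Der_leibniz[OF A x y] Der_leibniz[OF B x y]
        Der_leibniz[OF A Der_degree[OF B x] y] Der_leibniz[OF A x Der_degree[OF B y]]
        Der_leibniz[OF B Der_degree[OF A x] y] Der_leibniz[OF B x Der_degree[OF A y]]
        Der_linear[OF A] Der_linear[OF B] br_linear eps_add_left eps_add_right
        scale_right_distrib scale_right_diff_distrib p mult_ac flip: p1_p2_q1_q2_r1_r2_def)
qed

lemma LD_skew:
  assumes "X \<in> LD i" "Y \<in> LD j"
  shows "LDbr X Y = - LD_scale scale (eps i j) (LDbr Y X)"
proof -
  obtain a A b B where X: "X = (a, A)" and Y: "Y = (b, B)"
    by (metis surj_pair)
  have a: "a \<in> T i" "A \<in> Der i" and b: "b \<in> T j" "B \<in> Der j"
    using assms by (auto simp: X Y LD_component_def)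
  have "br a b z = - scale (eps i j) (br b a z)" for z
    by (rule br_skew'[OF a(1) b(1)])
  then show ?thesis
    using assms eps_commute[of i j]
    by (simp add: X Y LD_bracket_homogeneous[of _ _ i _ _ j] LD_bracket_homogeneous[of _ _ j _ _ i]
        LD_scale_def scale_right_distrib scale_right_diff_distrib fun_eq_iff)
qed

lemma LD_degree:
  assumes "X \<in> LD i" "Y \<in> LD j"
  shows "LDbr X Y \<in> LD (i + j)"
proof -
  interpret der: graded_space fun_scale Der by (rule graded_space_Der)
  obtain a A b B where X: "X = (a, A)" and Y: "Y = (b, B)"
    by (metis surj_pair)
  have a: "a \<in> T i" "A \<in> Der i" and b: "b \<in> T j" "B \<in> Der j"
    using assms by (auto simp: X Y LD_component_def)
  have "A b - scale (eps i j) (B a) \<in> T (i + j)"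
    using Der_degree[OF a(2) b(1)] Der_degree[OF b(2) a(1)]
    by (auto intro!: subspace_diff[OF subspace_component] subspace_scale[OF subspace_component]
        simp: add.commute)
  moreover have "(\<lambda>z. br a b z + A (B z) - scale (eps i j) (B (A z))) \<in> Der (i + j)"
    using der.subspace_add[OF der.subspace_component inner_Der[OF a(1) b(1)] comp_Der[OF a(2) b(2)]]
    by (simp add: plus_fun_def algebra_simps)
  ultimately show ?thesis
    using assms by (simp add: X Y LD_bracket_homogeneous[of _ _ i _ _ j] LD_component_def)
qed

text \<open>Splitting the arguments into their parts in \<open>T\<close> and \<open>Der(T)\<close>
  separates the content: three elements of \<open>T\<close> give the cyclic axiom, two give the
  Leibniz rule of a derivation, one or none the definition and the Jacobi identity of color
  commutators.\<close>

lemma LD_jacobi: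
  assumes X: "X \<in> LD i" and Y: "Y \<in> LD j" and Z: "Z \<in> LD k"
  shows "LD_scale scale (eps k i) (LDbr X (LDbr Y Z)) + LD_scale scale (eps i j) (LDbr Y (LDbr Z X))
    + LD_scale scale (eps j k) (LDbr Z (LDbr X Y)) = 0"
proof -
  obtain a A b B c C where XYZ: "X = (a, A)" "Y = (b, B)" "Z = (c, C)"
    by (metis surj_pair)
  have a: "a \<in> T i" and A: "A \<in> Der i" and b: "b \<in> T j" and B: "B \<in> Der j"
    and c: "c \<in> T k" and C: "C \<in> Der k"
    using assms by (auto simp: XYZ LD_component_def)
  define p1 p2 q1 q2 r1 r2 where eps_defs: "p1 = eps i j" "p2 = eps j i" "q1 = eps j k" "q2 = eps k j"
    "r1 = eps k i" "r2 = eps i k"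
  have cancel: "p1 * p2 = 1" "p1 * (p2 * w) = w" "q1 * q2 = 1" "q1 * (q2 * w) = w"
    "r1 * r2 = 1" "r1 * (r2 * w) = w" for w
    using eps_commute[of i j] eps_commute[of j k] eps_commute[of k i]
    by (simp_all add: eps_defs flip: mult.assoc)
  note homogeneous = LD_bracket_homogeneous[of _ _ i _ _ j] LD_bracket_homogeneous[of _ _ j _ _ k]
    LD_bracket_homogeneous[of _ _ k _ _ i] LD_bracket_homogeneous[of _ _ i _ _ "j + k"]
    LD_bracket_homogeneous[of _ _ j _ _ "k + i"] LD_bracket_homogeneous[of _ _ k _ _ "i + j"]
  note YZ = LD_degree[OF Y Z, unfolded XYZ] and ZX = LD_degree[OF Z X, unfolded XYZ]
    and XY = LD_degree[OF X Y, unfolded XYZ]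
  note [simp] = Der_linear[OF A] Der_linear[OF B] Der_linear[OF C] br_linear
    eps_add_left eps_add_right scale_right_distrib scale_right_diff_distrib
  \<comment> \<open>A rewrite rule eliminating \<open>br c a b\<close>; the cyclic axiom is
    multiplied by \<open>q2\<close>, the inverse of \<open>q1\<close>, to give that term coefficient
    1.\<close>
  have cyclic: "br c a b = - scale (q2 * r1) (br a b c) - scale (p1 * q2) (br b c a)"
  proof -
    have "scale q2 (scale r1 (br a b c) + scale p1 (br b c a) + scale q1 (br c a b)) = 0"
      using br_cyclic[OF a b c] by (simp add: eps_defs)
    then have "br c a b + (scale (q2 * r1) (br a b c) + scale (p1 * q2) (br b c a)) = 0"
      using cancel(3) by (simp add: mult.commute add_ac)
    then show ?thesis by (simp add: eq_neg_iff_add_eq_0 eq_diff_eq add_ac)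
  qed
  \<comment> \<open>Brackets with a derived argument are brought to one order, so that opposite
    terms from the Leibniz rules meet.\<close>
  have skew: "br (A b) c w = - scale (r2 * q1) (br c (A b) w)"
    "br (B c) a w = - scale (p2 * r1) (br a (B c) w)"
    "br (C a) b w = - scale (q2 * p1) (br b (C a) w)" for w
    using br_skew'[OF Der_degree[OF A b] c] br_skew'[OF Der_degree[OF B c] a]
      br_skew'[OF Der_degree[OF C a] b] by (simp_all add: eps_defs)
  show ?thesis
    using X Y Z YZ ZX XY
    by (simp add: XYZ homogeneous LD_scale_def fun_eq_iff zero_prod_def)
      (simp add: Der_leibniz[OF A b c] Der_leibniz[OF B c a] Der_leibniz[OF C a b]
        cyclic skew cancel mult_ac flip: eps_defs)
qed

lemma Der_total_linear:
  assumes "D \<in> graded_space.total fun_scale Der"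
  shows "D (x + y) = D x + D y" "D (scale c x) = scale c (D x)"
proof -
  interpret der: graded_space fun_scale Der by (rule graded_space_Der)
  show "D (x + y) = D x + D y"
    using assms by (induction rule: der.total_induct) (simp_all add: Der_linear)
  show "D (scale c x) = scale c (D x)"
    using assms by (induction rule: der.total_induct) (simp_all add: Der_linear scale_right_distrib)
qed

lemma LD_total_snd:
  assumes "X \<in> graded_space.total (LD_scale scale) LD"
  shows "snd X \<in> graded_space.total fun_scale Der"
proof -
  interpret der: graded_space fun_scale Der by (rule graded_space_Der)
  interpret LD: graded_space "LD_scale scale" LD by (rule graded_space_LD)
  show ?thesis
    using assms
  proof (induction rule: LD.total_induct)
    case zero
    show ?case unfolding snd_zero by (rule der.subspace_0[OF der.subspace_total])
  next
    case (homogeneous g X)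
    then show ?case by (auto simp: LD_component_def intro: der.component_total)
  next
    case (add X Y)
    then show ?case unfolding snd_add by (intro der.subspace_add[OF der.subspace_total])
  qed
qed

theorem lie_color_algebra_LD: "lie_color_algebra (LD_scale scale) LD eps LDbr"
proof -
  interpret der: graded_space fun_scale Der by (rule graded_space_Der)
  interpret LD: graded_space "LD_scale scale" LD by (rule graded_space_LD)
  interpret app: graded_pairing scale T fun_scale Der scale eps "\<lambda>a B. B a"
    by (rule graded_pairing_apply)
  interpret comp: graded_pairing fun_scale Der fun_scale Der scale eps "\<lambda>A B. B (A z)" for z
    by (rule graded_pairing_comp)
  have T: "x \<in> total" for x by (simp add: total_UNIV)
  note [simp] = LD_bracket_eq LD_scale_def fun_eq_iff br_linear Der_total_linear
  show ?thesis
  proof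
    fix X Y Z :: "'t \<times> ('t \<Rightarrow> 't)" and c assume X: "X \<in> LD.total" and Y: "Y \<in> LD.total"
    obtain x D y E z F where XYZ: "X = (x, D)" "Y = (y, E)" "Z = (z, F)"
      by (metis surj_pair)
    have D: "D \<in> der.total" and E: "E \<in> der.total"
      using LD_total_snd[OF X] LD_total_snd[OF Y] by (simp_all add: XYZ)
    show "LDbr (LD_scale scale c X) Y = LD_scale scale c (LDbr X Y)"
      using D E by (simp add: XYZ app.pairing_scale_left[OF T] comp.pairing_scale_left
        scale_right_distrib scale_right_diff_distrib)
    show "LDbr X (LD_scale scale c Y) = LD_scale scale c (LDbr X Y)"
      using D E by (simp add: XYZ app.pairing_scale_right[OF T] comp.pairing_scale_right
        scale_right_distrib scale_right_diff_distrib)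
    assume Z: "Z \<in> LD.total"
    have F: "F \<in> der.total"
      using LD_total_snd[OF Z] by (simp add: XYZ)
    show "LDbr (X + Y) Z = LDbr X Z + LDbr Y Z"
      using D E F
      by (simp add: XYZ app.pairing_add_left[OF T T] comp.pairing_add_left algebra_simps)
    show "LDbr X (Y + Z) = LDbr X Y + LDbr X Z"
      using D E F
      by (simp add: XYZ app.pairing_add_right[OF T] comp.pairing_add_right algebra_simps)
  qed (fact LD_degree LD_skew LD_jacobi)+
qed

interpretation LD: lie_color_algebra "LD_scale scale" LD eps LDbr
  by (rule lie_color_algebra_LD)

section \<open>Inner p-th powers in \<open>L_D(T)\<close>\<close>

lemma zero_T: "0 \<in> T i"
  by (rule subspace_0[OF subspace_component])

lemma zero_Der: "0 \<in> Der i"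
  by (rule DerI) (auto intro!: linearI simp: br_linear zero_T)

lemma LD_T: "(x, 0) \<in> LD i \<longleftrightarrow> x \<in> T i"
  and LD_Der: "(0, D) \<in> LD i \<longleftrightarrow> D \<in> Der i"
  by (simp_all add: LD_component_def zero_T zero_Der)

lemma LD_scale_T: "LD_scale scale a (x, 0) = (scale a x, 0)"
  by (simp add: LD_scale_def fun_eq_iff)

lemma LDbr_T_T: "\<lbrakk>a \<in> T i; b \<in> T j\<rbrakk> \<Longrightarrow> LDbr (a, 0) (b, 0) = (0, br a b)"
  by (simp add: LD_bracket_homogeneous[of a 0 i b 0 j] LD_T fun_eq_iff)

lemma LDbr_Der_T: "\<lbrakk>D \<in> Der i; b \<in> T j\<rbrakk> \<Longrightarrow> LDbr (0, D) (b, 0) = (D b, 0)"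
  by (simp add: LD_bracket_homogeneous[of 0 D i b 0 j] LD_T LD_Der fun_eq_iff Der_linear br_linear)

lemma LDbr_T_Der:
  "\<lbrakk>a \<in> T i; E \<in> Der j\<rbrakk> \<Longrightarrow> LDbr (a, 0) (0, E) = (- scale (eps i j) (E a), 0)"
  by (simp add: LD_bracket_homogeneous[of a 0 i 0 E j] LD_T LD_Der fun_eq_iff Der_linear br_linear)

lemma LDbr_triple:
  "\<lbrakk>a \<in> T i; b \<in> T j; c \<in> T k\<rbrakk> \<Longrightarrow> LDbr (LDbr (a, 0) (b, 0)) (c, 0) = (br a b c, 0)"
  using LDbr_Der_T[OF inner_Der] by (simp add: LDbr_T_T)

text \<open>For \<open>w = (u, U)\<close> the bracket with \<open>(z, 0)\<close> is
  \<open>(U z, br u z)\<close>. Its vanishing for all \<open>z\<close> gives \<open>U = 0\<close>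
  and puts \<open>u\<close> into the center.\<close>

lemma LD_faithful:
  assumes center: "triple_center br = {0}" and w: "w \<in> LD d"
    and zero: "\<And>k z. z \<in> T k \<Longrightarrow> LDbr w (z, 0) = 0"
  shows "w = 0"
proof -
  obtain u U where uU: "w = (u, U)" by (metis surj_pair)
  have U: "U \<in> Der d" using w by (simp add: uU LD_component_def)
  have "U z = 0 \<and> (\<forall>v. br u z v = 0)" for z
  proof (induction z rule: homogeneous_induct)
    case (homogeneous g z)
    then have "LDbr w (z, 0) = (U z, br u z)"
      using w LD_bracket_homogeneous[of u U d z 0 g]
      by (simp add: uU LD_T fun_eq_iff Der_linear[OF U])
    then show ?case
      using zero[OF homogeneous] by (auto simp: zero_prod_def dest: fun_cong)
  qed (simp_all add: Der_linear[OF U] br_linear)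
  then have "U = 0" and "u \<in> triple_center br"
    by (auto simp: fun_eq_iff triple_center_def)
  then show ?thesis
    using center by (simp add: uU zero_prod_def)
qed

text \<open>With \<open>zero_fun_apply\<close> the simplifier would turn the component \<open>0\<close> of \<open>(x, 0)\<close> into
  \<open>\<lambda>a. 0\<close>.\<close>

declare zero_fun_apply [simp del]

text \<open>A \<open>p\<close>-th power that is correct on \<open>T\<close> is correct on \<open>Der(T)\<close>, because \<open>[W, E]\<close> and
  \<open>(ad X)\<^sup>p(E)\<close> have the same brackets with the elements of \<open>T\<close>.\<close>

lemma is_p_power_LD:
  assumes p: "prime p" "of_nat p = (0::'k)" and center: "triple_center br = {0}"
    and c: "c \<in> even_degrees eps" and X: "X \<in> LD c" and W: "W \<in> LD (nat_mult p c)"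
    and T: "\<And>k z. z \<in> T k \<Longrightarrow> LDbr W (z, 0) = (LDbr X ^^ p) (z, 0)"
  shows "LD.is_p_power p c X W"
proof -
  note tot = LD.component_total[OF X] LD.component_total[OF W]
  have Der: "LDbr W (0, E) = (LDbr X ^^ p) (0, E)" if E: "E \<in> Der d" for E d
  proof -
    have E': "(0, E) \<in> LD d" using E by (simp add: LD_Der)
    note E_tot = LD.component_total[OF E']
    have "LDbr W (0, E) - (LDbr X ^^ p) (0, E) = 0"
    proof (rule LD_faithful[OF center])
      show diff: "LDbr W (0, E) - (LDbr X ^^ p) (0, E) \<in> LD (nat_mult p c + d)"
        by (intro LD.subspace_diff[OF LD.subspace_component] LD_degree W E'
            LD.funpow_br_degree X)
      fix k z assume z: "z \<in> T k"
      have z': "(z, 0) \<in> LD k" using z by (simp add: LD_T)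
      note z_tot = LD.component_total[OF z']
      have Ez: "LDbr (0, E) (z, 0) = (E z, 0)"
        using E z by (rule LDbr_Der_T)
      have "LDbr (LDbr W (0, E)) (z, 0) = LDbr W (E z, 0)
          - LD_scale scale (eps c d ^ p) (LDbr (0, E) (LDbr W (z, 0)))"
        using LD.br_br_homogeneous[OF W E' z'] by (simp add: Ez eps_nat_mult_left)
      \<comment> \<open>\<open>E z\<close> lies in \<open>T\<close> again, where \<open>W\<close> is
        correct by assumption.\<close>
      also have "LDbr W (E z, 0) = (LDbr X ^^ p) (LDbr (0, E) (z, 0))"
        using T[OF Der_degree[OF E z]] by (simp add: Ez)
      also have "\<dots> = LDbr ((LDbr X ^^ p) (0, E)) (z, 0)
          + LD_scale scale (eps c d ^ p) (LDbr (0, E) ((LDbr X ^^ p) (z, 0)))"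
        by (rule LD.funpow_br_leibniz[OF p c X E' z_tot])
      finally have eq: "LDbr (LDbr W (0, E)) (z, 0) = LDbr ((LDbr X ^^ p) (0, E)) (z, 0)"
        by (simp add: T[OF z])
      show "LDbr (LDbr W (0, E) - (LDbr X ^^ p) (0, E)) (z, 0) = 0"
        using LD.br_add_left[OF LD.component_total[OF diff] LD.funpow_br_total[OF tot(1) E_tot, of p] z_tot]
        by (simp add: eq)
    qed
    then show ?thesis by simp
  qed
  have "LDbr W v = (LDbr X ^^ p) v" if "v \<in> LD.total" for v
    using that
  proof (induction rule: LD.total_induct)
    case zero
    then show ?case
      using T[OF zero_T[of 0]] by (simp add: zero_prod_def)
  next
    case (homogeneous d v)
    then obtain z E where v: "v = (z, 0) + (0, E)" and z: "z \<in> T d" and E: "E \<in> Der d"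
      by (auto simp: LD_component_def)
    have "(z, 0) \<in> LD.total" "(0, E) \<in> LD.total"
      using z E LD_T LD_Der LD.component_total by blast+
    then show ?case
      unfolding v by (simp only: LD.br_add_right LD.funpow_br_add tot T[OF z] Der[OF E])
  next
    case (add v v')
    then show ?case by (simp add: LD.br_add_right LD.funpow_br_add tot)
  qed
  then show ?thesis
    using W by (simp add: LD.is_p_power_def)
qed

text \<open>\<open>D ^^ p\<close> acts on \<open>T\<close> as the \<open>p\<close>-th power of
  \<open>ad (0, D)\<close>. With \<open>br x y z\<close> written as the double bracket
  \<open>[[x, y], z]\<close> in \<open>L_D(T)\<close>, two uses of \<open>funpow_br_leibniz\<close>
  give the ternary Leibniz rule and spare a ternary binomial expansion.\<close>

lemma is_p_power_Der:
  assumes p: "prime p" "of_nat p = (0::'k)" and center: "triple_center br = {0}"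
    and c: "c \<in> even_degrees eps" and D: "D \<in> Der c"
  shows "LD.is_p_power p c (0, D) (0, D ^^ p)"
proof -
  have D': "(0, D) \<in> LD c" using D by (simp add: LD_Der)
  have deg: "(D ^^ n) x \<in> T (nat_mult n c + i)" if "x \<in> T i" for n x i
    using that by (induction n) (auto simp: nat_mult_0 nat_mult_Suc add.assoc intro: Der_degree[OF D])
  have pow: "(LDbr (0, D) ^^ n) (x, 0) = ((D ^^ n) x, 0)" if "x \<in> T i" for n x i
    by (induction n) (simp_all add: LDbr_Der_T[OF D deg[OF that]])
  have "D ^^ p \<in> Der (nat_mult p c)"
  proof (rule DerI)
    show "Vector_Spaces.linear scale scale (D ^^ p)"
    proof (rule linearI)
      show "(D ^^ n) (x + y) = (D ^^ n) x + (D ^^ n) y" for n x y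
        by (induction n) (simp_all add: Der_linear[OF D])
      show "(D ^^ n) (scale a x) = scale a ((D ^^ n) x)" for n a x
        by (induction n) (simp_all add: Der_linear[OF D])
    qed
    show "(D ^^ p) x \<in> T (nat_mult p c + i)" if "x \<in> T i" for x i
      by (rule deg[OF that])
    fix i j k x y z assume x: "x \<in> T i" and y: "y \<in> T j" and z: "z \<in> T k"
    let ?P = "LDbr (0, D) ^^ p"
    have L: "(x, 0) \<in> LD i" "(y, 0) \<in> LD j" "(z, 0) \<in> LD k"
      using x y z by (simp_all add: LD_T)
    have L_P: "((D ^^ p) x, 0) \<in> LD (nat_mult p c + i)" "((D ^^ p) y, 0) \<in> LD (nat_mult p c + j)"
      using deg x y by (simp_all add: LD_T)
    note br_tot = LD.component_total[OF LD_degree]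
    have xy: "?P (LDbr (x, 0) (y, 0)) = LDbr ((D ^^ p) x, 0) (y, 0)
        + LD_scale scale (eps c i ^ p) (LDbr (x, 0) ((D ^^ p) y, 0))"
      using LD.funpow_br_leibniz[OF p c D' L(1) LD.component_total[OF L(2)]]
      by (simp add: pow[OF x] pow[OF y])
    have "((D ^^ p) (br x y z), 0) = ?P (LDbr (LDbr (x, 0) (y, 0)) (z, 0))"
      using pow[OF br_degree[OF x y z]] by (simp add: LDbr_triple[OF x y z])
    also have "\<dots> = LDbr (?P (LDbr (x, 0) (y, 0))) (z, 0)
        + LD_scale scale (eps c (i + j) ^ p) (LDbr (LDbr (x, 0) (y, 0)) ((D ^^ p) z, 0))"
      using LD.funpow_br_leibniz[OF p c D' LD_degree[OF L(1,2)] LD.component_total[OF L(3)]]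
      by (simp add: pow[OF z])
    also have "LDbr (?P (LDbr (x, 0) (y, 0))) (z, 0) = LDbr (LDbr ((D ^^ p) x, 0) (y, 0)) (z, 0)
        + LD_scale scale (eps c i ^ p) (LDbr (LDbr (x, 0) ((D ^^ p) y, 0)) (z, 0))"
      unfolding xy
      using br_tot[OF L_P(1) L(2)] br_tot[OF L(1) L_P(2)] LD.component_total[OF L(3)]
      by (simp add: LD.br_add_left LD.br_scale_left LD.subspace_scale[OF LD.subspace_total])
    finally show "(D ^^ p) (br x y z) = br ((D ^^ p) x) y z
        + scale (eps (nat_mult p c) i) (br x ((D ^^ p) y) z)
        + scale (eps (nat_mult p c) (i + j)) (br x y ((D ^^ p) z))"
      by (simp add: LDbr_triple[OF deg[OF x] y z] LDbr_triple[OF x deg[OF y] z]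
          LDbr_triple[OF x y deg[OF z]] LD_scale_T eps_nat_mult_left)
  qed
  then show ?thesis
    by (intro is_p_power_LD[OF p center c D'])
      (simp_all add: LD_Der pow LDbr_Der_T[of _ "nat_mult p c"])
qed

lemma iterated_replicate_even:
  "iterated f (x # replicate (2 * m) y @ ws) = iterated f (((\<lambda>u. f u y y) ^^ m) x # ws)"
  by (induction m arbitrary: x) (simp_all add: funpow_swap1[of "\<lambda>u. f u y y"])

text \<open>\<open>ad x\<close> alternates between \<open>T\<close> and \<open>Der(T)\<close>. Two
  steps give \<open>[x, [x, z]] = eps c k ^ 2 * [z, x, x]\<close>: the bracket of \<open>x\<close>
  with a derivation and skew-symmetry each contribute a sign and a factor \<open>eps c k\<close>.
  For odd \<open>p\<close> one more step ends in \<open>Der(T)\<close> with total factor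
  \<open>- eps c k ^ p\<close>, and the same factor arises from exchanging \<open>w\<close> and
  \<open>z\<close> in \<open>[w, z, v]\<close>.\<close>

lemma is_p_power_T:
  assumes p: "prime p" "of_nat p = (0::'k)" "odd p" and center: "triple_center br = {0}"
    and c: "c \<in> even_degrees eps" and x: "x \<in> T c" and w: "w \<in> T (nat_mult p c)"
    and br_w: "\<And>y z. br y w z = iterated br (y # replicate p x @ [z])"
  shows "LD.is_p_power p c (x, 0) (w, 0)"
proof (rule is_p_power_LD[OF p(1,2) center c])
  show "(x, 0) \<in> LD c" "(w, 0) \<in> LD (nat_mult p c)"
    using x w by (simp_all add: LD_T)
  fix k z assume z: "z \<in> T k"
  obtain m where m: "p = 2 * m + 1"
    using p(3) by (rule oddE)
  define R where "R u = br u x x" for u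
  have eps_c: "eps c c = 1" using c by (simp add: even_degrees_def)
  have R_deg: "(R ^^ n) z \<in> T (nat_mult (2 * n) c + k)" for n
  proof (induction n)
    case 0
    show ?case using z by (simp add: nat_mult_0)
  next
    case (Suc n)
    show ?case using br_degree[OF Suc.IH x x] by (simp add: nat_mult_Suc R_def add_ac)
  qed
  have eps_R: "eps c (nat_mult n c + k) = eps c k" for n
    by (rule LD.eps_even[OF c])
  \<comment> \<open>The scalar \<open>a\<close> carries the factor accumulated by earlier steps, so
    that the statement can be iterated.\<close>
  have twice: "LDbr (x, 0) (LDbr (x, 0) (scale a u, 0)) = (scale (eps c k ^ 2 * a) (R u), 0)"
    if u: "u \<in> T (nat_mult n c + k)" for a u n
  proof -
    have au: "scale a u \<in> T (nat_mult n c + k)"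
      by (rule subspace_scale[OF subspace_component u])
    have "br x u x = - scale (eps c k) (R u)"
      using br_skew'[OF x u] by (simp add: R_def eps_R)
    then show ?thesis
      by (simp add: LDbr_T_T[OF x au] LDbr_T_Der[OF x inner_Der[OF x au]] eps_add_right eps_c
          eps_nat_mult_right br_linear power2_eq_square mult_ac)
  qed
  have pow: "(LDbr (x, 0) ^^ (2 * n)) (z, 0) = (scale (eps c k ^ (2 * n)) ((R ^^ n) z), 0)" for n
    by (induction n) (simp_all add: twice[OF R_deg] power2_eq_square mult.assoc)
  have "(LDbr (x, 0) ^^ p) (z, 0) = LDbr (x, 0) (scale (eps c k ^ (2 * m)) ((R ^^ m) z), 0)"
    by (simp add: m pow)
  also have "\<dots> = (0, \<lambda>v. scale (eps c k ^ (2 * m)) (br x ((R ^^ m) z) v))"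
    by (simp add: LDbr_T_T[OF x subspace_scale[OF subspace_component R_deg]] fun_eq_iff br_linear)
  also have "\<dots> = (0, \<lambda>v. - scale (eps c k ^ p) (br ((R ^^ m) z) x v))"
    using br_skew'[OF x R_deg[of m]] by (simp add: eps_R m mult.commute)
  also have "\<dots> = (0, \<lambda>v. - scale (eps c k ^ p) (br z w v))"
  proof -
    \<comment> \<open>The last copy of \<open>x\<close> is left over when the pairs are consumed and
      becomes the middle argument of the final product with \<open>v\<close>.\<close>
    have "replicate p x = replicate (2 * m) x @ [x]"
      by (simp add: m replicate_append_same)
    then have "br z w v = br ((R ^^ m) z) x v" for v
      using br_w[of z v] iterated_replicate_even[of br z m x "[x, v]"]
      by (simp add: R_def[abs_def])
    then show ?thesis by simp
  qed
  also have "\<dots> = LDbr (w, 0) (z, 0)"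
    using br_skew'[OF w z] by (simp add: LDbr_T_T[OF w z] eps_nat_mult_left fun_eq_iff)
  finally show "LDbr (w, 0) (z, 0) = (LDbr (x, 0) ^^ p) (z, 0)" by simp
qed

end

theorem theorem3p23:
  fixes scale :: "'k::field \<Rightarrow> 't::ab_group_add \<Rightarrow> 't"
    and T :: "'g::ab_group_add \<Rightarrow> 't set"
    and eps :: "'g \<Rightarrow> 'g \<Rightarrow> 'k"
    and br :: "'t \<Rightarrow> 't \<Rightarrow> 't \<Rightarrow> 't"
    and p :: nat
    and pm :: "'g \<Rightarrow> 't \<Rightarrow> 't"
  assumes "CHAR('k) = p" and "p > 3"
    and "restricted_lie_color_triple_system scale T eps br p pm"
    and "triple_center br = {0}"
  shows "\<exists>pm'. restricted_lie_color_algebra (LD_scale scale) (LD_component scale T eps br) eps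
            (LD_bracket scale T eps br) p pm' \<and>
          (\<forall>c \<in> even_degrees eps. \<forall>x \<in> T c. pm' c (x, 0) = (pm c x, 0))"
proof -
  interpret restricted_lie_color_triple_system scale T eps br p pm by fact
  interpret LD: lie_color_algebra "LD_scale scale" LD eps LDbr
    by (rule lie_color_algebra_LD)
  have p: "prime p" "CHAR('k) = p"
    using assms(1,2) prime_CHAR_semidom[where ?'a = 'k] by auto
  have p0: "of_nat p = (0::'k)"
    using of_nat_CHAR[where ?'a = 'k] p(2) by simp
  have "odd p"
    using prime_odd_nat[OF p(1)] assms(2) by simp
  have power_T: "LD.is_p_power p c (x, 0) (pm c x, 0)" if c: "c \<in> even_degrees eps" and x: "x \<in> T c" for c x
    by (rule is_p_power_T[OF p(1) p0 \<open>odd p\<close> assms(4) c x pm_degree[OF c x] pm_br[OF c x]])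
  have faithful: "w = 0" if "w \<in> LD d" "\<And>v. v \<in> LD.total \<Longrightarrow> LDbr w v = 0" for d w
    using LD_faithful[OF assms(4) that(1)] that(2) LD_T LD.component_total by blast
  have powers: "\<exists>w. LD.is_p_power p c X w" if c: "c \<in> even_degrees eps" and X: "X \<in> LD c" for c X
  proof -
    obtain x D where X_eq: "X = (x, D)" and x: "x \<in> T c" and D: "D \<in> Der c"
      using X by (auto simp: LD_component_def)
    \<comment> \<open>By Jacobson's formula inside \<open>L_D(T)\<close> the value at a mixed
      element is \<open>x^[p] + D^p\<close> plus the sum of the \<open>s_i(x, D)\<close>.\<close>
    have "X = (x, 0) + (0, D)"
      by (simp add: X_eq)
    moreover have "(x, 0) \<in> LD c" "(0, D) \<in> LD c"
      using x D by (simp_all add: LD_T LD_Der)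
    note LD.is_p_power_add[OF p c this power_T[OF c x] is_p_power_Der[OF p(1) p0 assms(4) c D]]
    ultimately show ?thesis by (auto simp only:)
  qed
  show ?thesis
  proof (rule LD.restricted_of_inner_powers[OF p])
    fix w d assume "w \<in> LD d" "\<And>v. v \<in> LD.total \<Longrightarrow> LDbr w v = 0"
    then show "w = 0" by (rule faithful)
  next
    fix c X assume "c \<in> even_degrees eps" "X \<in> LD c"
    then show "\<exists>w. LD.is_p_power p c X w" by (rule powers)
  next
    fix pm'
    assume restricted: "restricted_lie_color_algebra (LD_scale scale) LD eps LDbr p pm'"
      and pm': "\<And>c x w. \<lbrakk>c \<in> even_degrees eps; x \<in> LD c; LD.is_p_power p c x w\<rbrakk> \<Longrightarrow> pm' c x = w"
    \<comment> \<open>The given p-map supplies a p-th power of \<open>(x, 0)\<close>, so uniqueness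
      of the values forces agreement on \<open>T\<close>.\<close>
    have "pm' c (x, 0) = (pm c x, 0)" if c: "c \<in> even_degrees eps" and x: "x \<in> T c" for c x
      using pm'[OF c _ power_T[OF c x]] x by (simp add: LD_T)
    then show ?thesis
      using restricted by blast
  qed
qed

end
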